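(* Let $0\le d<1/2$ be fixed and let $X_1,\dots,X_n$ be the first $n$ terms of a linear process $X_t=\sum_{i=0}^\infty a_i\varepsilon_{t-i}$ with memory parameter $d$ (short memory if $d=0$, long memory if $0<d<1/2$, as defined in the context), with i.i.d. mean-zero innovations of variance $\sigma^2\in(0,\infty)$. Let $S_n=X_1+\cdots+X_n$ and $$\beta_n=\frac{\mathbb{E}(S_n^3)}{\left[\mathrm{Var}(S_n)\right]^{3/2}}.$$ If $\eta=\mathbb{E}(\varepsilon_1^3)$ is finite then, as $n\to\infty$, $$\sqrt{n}\,\beta_n\to k(d):=\frac{\eta}{\sigma^3}\;\frac{\frac{1}{1+3d}+\int_0^\infty\left((1+x)^d-x^d\right)^3dx}{\left(\frac{1}{1+2d}+\int_0^\infty\left((1+x)^d-x^d\right)^2dx\right)^{3/2}}.$$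
   Context: The innovations $(\varepsilon_i)_{i\in\mathbb{Z}}$ are i.i.d. real random variables with mean $0$, variance $\sigma^2$, $0<\sigma^2<\infty$, and finite third moment. The real coefficients $(a_i)_{i\ge 0}$ are square summable. The process $X_t=\sum_{i=0}^\infty a_i\varepsilon_{t-i}$ (centred, i.e. mean $\mu=0$) is called short memory if $\sum_{i=0}^\infty|a_i|<\infty$, and this case is denoted by $d=0$. It is called long memory with parameter $d\in(0,1/2)$ if $a_i\sim c(d)\,i^{d-1}$ as $i\to\infty$ for some constant $c(d)>0$, where $\ell_n\sim\lambda_n$ means $\ell_n=\lambda_n(1+o(1))$. It is assumed that the limiting variance $v(d)=\lim_{n\to\infty}n^{-1-2d}\mathrm{Var}(S_n)$ is strictly positive.
   Formalization: For d=0 the formal statement also assumes sum a_i > 0; as printed the claim fails if sum a_i < 0 and eta is nonzero (e.g. a_0=-1, other a_i=0 gives limit -eta/sigma^3 instead of k(0)). *)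

theory Defs
  imports "HOL-Probability.Probability" "HOL-Library.Landau_Symbols"
begin

definition iid :: "'w measure \<Rightarrow> (int \<Rightarrow> 'w \<Rightarrow> real) \<Rightarrow> bool" where
  "iid M \<epsilon> \<longleftrightarrow>
     prob_space.indep_vars M (\<lambda>_. borel) \<epsilon> UNIV \<and>
     (\<forall>i j. distr M borel (\<epsilon> i) = distr M borel (\<epsilon> j))"

text \<open>
  The defining series is read as almost sure convergence of its partial sums. For independent
  centred innovations of finite variance and square summable coefficients the series does converge
  almost surely (Kolmogorov), and its sum is then also the mean-square limit, so such an \<open>X\<close> exists
  and is unique up to null sets.
\<close>

definition linear_process ::
  "'w measure \<Rightarrow> (nat \<Rightarrow> real) \<Rightarrow> (int \<Rightarrow> 'w \<Rightarrow> real) \<Rightarrow> (int \<Rightarrow> 'w \<Rightarrow> real) \<Rightarrow> bool" where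
  "linear_process M a \<epsilon> X \<longleftrightarrow>
     (\<forall>t. X t \<in> borel_measurable M \<and>
          (AE \<omega> in M. (\<lambda>i. a i * \<epsilon> (t - int i) \<omega>) sums X t \<omega>))"

definition short_memory :: "(nat \<Rightarrow> real) \<Rightarrow> bool" where
  "short_memory a \<longleftrightarrow> summable (\<lambda>i. \<bar>a i\<bar>)"

definition long_memory :: "real \<Rightarrow> (nat \<Rightarrow> real) \<Rightarrow> bool" where
  "long_memory d a \<longleftrightarrow> (\<exists>c>0. a \<sim>[at_top] (\<lambda>i. c * real i powr (d - 1)))"

definition has_memory :: "real \<Rightarrow> (nat \<Rightarrow> real) \<Rightarrow> bool" where
  "has_memory d a \<longleftrightarrow> (if d = 0 then short_memory a else long_memory d a)"

definition partial_sum :: "(int \<Rightarrow> 'w \<Rightarrow> real) \<Rightarrow> nat \<Rightarrow> 'w \<Rightarrow> real" where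
  "partial_sum X n \<omega> = (\<Sum>t\<in>{1..int n}. X t \<omega>)"

definition skewness_sum :: "'w measure \<Rightarrow> (int \<Rightarrow> 'w \<Rightarrow> real) \<Rightarrow> nat \<Rightarrow> real" where
  "skewness_sum M X n =
     prob_space.expectation M (\<lambda>\<omega>. partial_sum X n \<omega> ^ 3) /
     prob_space.variance M (partial_sum X n) powr (3/2)"

text \<open>
  As \<open>0 powr 0 = 0\<close>, the integrands at \<open>d = 0\<close> deviate from \<open>(1 + x)\<^sup>0 - x\<^sup>0 = 0\<close> at
  the single point \<open>x = 0\<close>, which does not affect the integrals.
\<close>

definition skewness_limit :: "real \<Rightarrow> real \<Rightarrow> real \<Rightarrow> real" where
  "skewness_limit \<eta> \<sigma> d =
     \<eta> / \<sigma> ^ 3 *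
     ((1 / (1 + 3 * d) + (LBINT x:{0..}. ((1 + x) powr d - x powr d) ^ 3)) /
      (1 / (1 + 2 * d) + (LBINT x:{0..}. ((1 + x) powr d - x powr d) ^ 2)) powr (3/2))"

end

theory Submission
  imports Defs "HOL-Real_Asymp.Real_Asymp"
begin

text \<open>
  Write \<open>S_n = (\<Sum>k. b_{n,k} \<epsilon>_{n-k})\<close>, where \<open>b_{n,k}\<close> is a sum of at most \<open>n\<close> consecutive
  coefficients. By independence and centring the second and third moments of \<open>S_n\<close> are
  \<open>\<sigma>\<^sup>2 (\<Sum>k. b_{n,k}\<^sup>2)\<close> and \<open>\<eta> (\<Sum>k. b_{n,k}\<^sup>3)\<close>. Only third moments are available, so the interchange
  of limit and third moment rests on a Rosenthal-type bound for \<open>E \<bar>T\<bar>\<^sup>3\<close>, which gives \<open>L\<^sup>3\<close>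
  convergence of the almost surely convergent series.

  If \<open>A\<close> denotes the partial sums of the coefficients, then \<open>A m \<sim> C m\<^sup>d\<close> with \<open>C > 0\<close>,
  \<open>b_{n,k} = A (k + 1)\<close> for \<open>k < n\<close> and \<open>b_{n,n+m} = A (n + m + 1) - A (m + 1)\<close>. So
  \<open>n powr (- 1 - p d) * (\<Sum>k. b_{n,k} ^ p)\<close> is a Cesaro mean with limit \<open>C ^ p / (1 + p d)\<close>, plus the
  integral of a step function which converges, dominatedly if \<open>d > 0\<close>, to
  \<open>C ^ p (\<integral>x\<ge>0. ((1 + x)\<^sup>d - x\<^sup>d) ^ p)\<close>. The constant \<open>C\<close> cancels in the skewness.
\<close>

section \<open>Sums with regularly varying terms\<close>

text \<open>Stolz-Cesaro in weighted-average form. Past some \<open>N\<close> every term deviates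
  from \<open>L * v k\<close> by at most \<open>e / 2 * v k\<close>; the earlier terms give a fixed
  error, which the diverging total weight absorbs.\<close>

lemma stolz_cesaro_sum:
  fixes u v :: "nat \<Rightarrow> real"
  assumes v: "\<And>k. v k > 0" and V: "filterlim (\<lambda>n. \<Sum>k<n. v k) at_top sequentially"
    and lim: "(\<lambda>k. u k / v k) \<longlonglongrightarrow> L"
  shows "(\<lambda>n. (\<Sum>k<n. u k) / (\<Sum>k<n. v k)) \<longlonglongrightarrow> L"
proof (rule LIMSEQ_I)
  fix e :: real assume e: "e > 0"
  from LIMSEQ_D[OF lim, of "e / 2"] e obtain N where N: "\<And>k. k \<ge> N \<Longrightarrow> \<bar>u k / v k - L\<bar> < e / 2"
    by auto
  define C where "C = (\<Sum>k<N. \<bar>u k - L * v k\<bar>)"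
  \<comment> \<open>A bound valid for all \<open>k\<close>, so that it can be summed over
    \<open>k < n\<close> without distinguishing \<open>n\<close> from \<open>N\<close>.\<close>
  have tail: "\<bar>u k - L * v k\<bar> \<le> (if k < N then \<bar>u k - L * v k\<bar> else 0) + e / 2 * v k" for k
  proof (cases "k < N")
    case True
    then show ?thesis using e v[of k] by simp
  next
    case False
    have "\<bar>u k - L * v k\<bar> = \<bar>u k / v k - L\<bar> * v k"
      using v[of k] by (simp add: abs_mult_pos' field_simps flip: abs_mult_pos)
    also have "\<dots> \<le> e / 2 * v k"
      using N[of k] False v[of k] by (intro mult_right_mono) auto
    finally show ?thesis using False by simp
  qed
  have "\<forall>\<^sub>F n in sequentially. (\<Sum>k<n. v k) > max 0 (2 * C / e)"
    using V unfolding filterlim_at_top_dense by blast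
  then obtain n0 where n0: "\<And>n. n \<ge> n0 \<Longrightarrow> (\<Sum>k<n. v k) > max 0 (2 * C / e)"
    unfolding eventually_sequentially by blast
  show "\<exists>n0. \<forall>n\<ge>n0. norm ((\<Sum>k<n. u k) / (\<Sum>k<n. v k) - L) < e"
  proof (intro exI allI impI)
    fix n assume "n \<ge> n0"
    define W where "W = (\<Sum>k<n. v k)"
    have W: "W > 0" "2 * C / e < W" using n0[OF \<open>n \<ge> n0\<close>] by (auto simp: W_def)
    have "\<bar>(\<Sum>k<n. u k) - L * W\<bar> = \<bar>\<Sum>k<n. u k - L * v k\<bar>"
      by (simp add: W_def sum_subtractf sum_distrib_left)
    also have "\<dots> \<le> (\<Sum>k<n. \<bar>u k - L * v k\<bar>)" by (rule sum_abs)
    also have "\<dots> \<le> (\<Sum>k<n. (if k < N then \<bar>u k - L * v k\<bar> else 0) + e / 2 * v k)"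
      by (intro sum_mono tail)
    also have "\<dots> = (\<Sum>k\<in>{..<n} \<inter> {..<N}. \<bar>u k - L * v k\<bar>) + e / 2 * W"
      by (simp add: sum.distrib W_def sum_distrib_left sum.If_cases lessThan_def)
    also have "(\<Sum>k\<in>{..<n} \<inter> {..<N}. \<bar>u k - L * v k\<bar>) \<le> C"
      unfolding C_def by (intro sum_mono2) auto
    also have "C < e / 2 * W" using W e by (simp add: field_simps)
    finally have le: "\<bar>(\<Sum>k<n. u k) - L * W\<bar> < e * W" by (simp add: mult.commute)
    have "(\<Sum>k<n. u k) / W - L = ((\<Sum>k<n. u k) - L * W) / W"
      using W by (simp add: field_simps)
    then have "norm ((\<Sum>k<n. u k) / W - L) = \<bar>(\<Sum>k<n. u k) - L * W\<bar> / W"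
      using W by simp
    also have "\<dots> < e" using le W by (simp add: field_simps)
    finally show "norm ((\<Sum>k<n. u k) / (\<Sum>k<n. v k) - L) < e" by (simp add: W_def)
  qed
qed

text \<open>The increments of \<open>k powr (q + 1)\<close> telescope and are asymptotic to
  \<open>(q + 1) * k powr q\<close>. For \<open>q > -1\<close> they are positive with divergent sum,
  hence admissible weights in \<open>stolz_cesaro_sum\<close>.\<close>

lemma sum_asymp_powr:
  fixes u :: "nat \<Rightarrow> real" and q L :: real
  assumes q: "q > -1" and lim: "(\<lambda>k. u k / real k powr q) \<longlonglongrightarrow> L"
  shows "(\<lambda>n. (\<Sum>k<n. u k) / real n powr (q + 1)) \<longlonglongrightarrow> L / (q + 1)"
proof -
  define v where "v k = real (Suc k) powr (q + 1) - real k powr (q + 1)" for k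
  have V: "(\<Sum>k<n. v k) = real n powr (q + 1)" for n
    unfolding v_def by (subst sum_lessThan_telescope) simp
  have v0: "v k > 0" for k
    unfolding v_def using q by (simp add: powr_less_mono2)
  have "(\<lambda>k. v k / real k powr q) \<longlonglongrightarrow> q + 1"
    unfolding v_def using q by real_asymp
  then have "(\<lambda>k. (u k / real k powr q) / (v k / real k powr q)) \<longlonglongrightarrow> L / (q + 1)"
    using q by (intro tendsto_divide lim) auto
  moreover have "\<forall>\<^sub>F k in sequentially. (u k / real k powr q) / (v k / real k powr q) = u k / v k"
    using eventually_gt_at_top[of 0] by eventually_elim simp
  ultimately have uv: "(\<lambda>k. u k / v k) \<longlonglongrightarrow> L / (q + 1)"
    by (rule Lim_transform_eventually)
  have "filterlim (\<lambda>n. real n powr (q + 1)) at_top sequentially"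
    using q by real_asymp
  then show ?thesis
    using stolz_cesaro_sum[of v u, OF v0 _ uv] by (simp add: V)
qed

text \<open>Factor \<open>A (m n) / n powr d\<close> through \<open>m n powr d\<close>. Since
  \<open>y > 0\<close>, \<open>m n\<close> tends to infinity, so the limit of \<open>A\<close> may
  be taken along \<open>m\<close>.\<close>

lemma asymp_powr_compose:
  fixes A :: "nat \<Rightarrow> real" and m :: "nat \<Rightarrow> nat"
  assumes lim: "(\<lambda>n. A n / real n powr d) \<longlonglongrightarrow> C"
    and m: "(\<lambda>n. real (m n) / real n) \<longlonglongrightarrow> y" and y: "y > 0"
  shows "(\<lambda>n. A (m n) / real n powr d) \<longlonglongrightarrow> C * y powr d"
proof -
  have "filterlim (\<lambda>n. real (m n) / real n * real n) at_top sequentially"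
    by (rule filterlim_tendsto_pos_mult_at_top[OF m y filterlim_real_sequentially])
  moreover have "\<forall>\<^sub>F n in sequentially. real (m n) / real n * real n = real (m n)"
    using eventually_gt_at_top[of 0] by eventually_elim simp
  ultimately have "filterlim (\<lambda>n. real (m n)) at_top sequentially"
    by (rule filterlim_cong[OF refl refl, THEN iffD1, rotated])
  then have m_top: "filterlim m at_top sequentially"
    by (simp add: filterlim_sequentially_iff_filterlim_real)
  have "(\<lambda>n. A (m n) / real (m n) powr d * (real (m n) / real n) powr d) \<longlonglongrightarrow> C * y powr d"
    using y by (intro tendsto_mult filterlim_compose[OF lim m_top] tendsto_powr m tendsto_const) auto
  moreover have "\<forall>\<^sub>F n in sequentially. A (m n) / real (m n) powr d * (real (m n) / real n) powr d
      = A (m n) / real n powr d"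
  proof -
    have "\<forall>\<^sub>F n in sequentially. m n > 0"
      using m_top unfolding filterlim_at_top by (auto simp: Suc_le_eq dest: spec[of _ 1])
    then show ?thesis
      by eventually_elim (simp add: powr_divide)
  qed
  ultimately show ?thesis by (rule Lim_transform_eventually)
qed

lemma floor_mult_asymp:
  fixes x :: real
  assumes "x \<ge> 0"
  shows "(\<lambda>n. real (nat \<lfloor>real n * x\<rfloor>) / real n) \<longlonglongrightarrow> x"
proof (rule tendsto_sandwich)
  show "\<forall>\<^sub>F n in sequentially. x - 1 / real n \<le> real (nat \<lfloor>real n * x\<rfloor>) / real n"
    using eventually_gt_at_top[of 0]
  proof eventually_elim
    case (elim n)
    have "real n * x - 1 \<le> real (nat \<lfloor>real n * x\<rfloor>)" by linarith
    then have "(real n * x - 1) / real n \<le> real (nat \<lfloor>real n * x\<rfloor>) / real n"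
      by (intro divide_right_mono) auto
    also have "(real n * x - 1) / real n = x - 1 / real n" using elim by (simp add: diff_divide_distrib)
    finally show ?case .
  qed
  show "\<forall>\<^sub>F n in sequentially. real (nat \<lfloor>real n * x\<rfloor>) / real n \<le> x"
    using eventually_gt_at_top[of 0]
  proof eventually_elim
    case (elim n)
    have "0 \<le> real n * x" using assms by simp
    then have "real (nat \<lfloor>real n * x\<rfloor>) \<le> real n * x" by linarith
    then show ?case using elim by (simp add: field_simps)
  qed
  show "(\<lambda>n. x - 1 / real n) \<longlonglongrightarrow> x" by real_asymp
qed simp

text \<open>The map from \<open>x\<close> to the floor of \<open>n * x\<close> pushes Lebesgue
  measure on the half-line to mass \<open>1 / n\<close> at every natural number. This turns a series
  into an integral, to which dominated convergence applies.\<close>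

lemma integral_floor_step:
  fixes f :: "nat \<Rightarrow> real"
  assumes f: "summable (\<lambda>k. \<bar>f k\<bar>)" and n: "n > 0"
  shows "(LBINT x:{0..}. f (nat \<lfloor>real n * x\<rfloor>)) = (\<Sum>k. f k) / real n"
proof -
  let ?g = "\<lambda>x::real. nat \<lfloor>real n * x\<rfloor>"
  let ?N = "restrict_space lborel {0::real..}"
  have meas: "?g \<in> measurable ?N (count_space UNIV)"
    by (rule measurable_restrict_space1) measurable
  have "distr ?N (count_space UNIV) ?g = density (count_space UNIV) (\<lambda>_. ennreal (1 / real n))"
  proof (rule measure_eqI_countable[where A = UNIV])
    fix k :: nat
    have "?g -` {k} \<inter> {0..} = {real k / real n ..< (real k + 1) / real n}"
    proof (intro equalityI subsetI)
      fix x assume "x \<in> ?g -` {k} \<inter> {0..}"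
      then have "x \<ge> 0" "nat \<lfloor>real n * x\<rfloor> = k" by auto
      moreover have "0 \<le> real n * x" using \<open>x \<ge> 0\<close> by simp
      ultimately have "real k \<le> real n * x" "real n * x < real k + 1"
        by linarith+
      then show "x \<in> {real k / real n ..< (real k + 1) / real n}" using n by (auto simp: field_simps)
    next
      fix x assume "x \<in> {real k / real n ..< (real k + 1) / real n}"
      then have *: "real k \<le> real n * x" "real n * x < real k + 1" using n by (auto simp: field_simps)
      then have "\<lfloor>real n * x\<rfloor> = int k" by linarith
      moreover have "0 \<le> real n * x" using *(1) by (rule order_trans[rotated]) simp
      then have "x \<ge> 0" using n by (simp add: zero_le_mult_iff)
      ultimately show "x \<in> ?g -` {k} \<inter> {0..}" by auto
    qed
    moreover from this have "{real k / real n ..< (real k + 1) / real n} \<subseteq> {0..}" by blast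
    ultimately have "emeasure (distr ?N (count_space UNIV) ?g) {k}
        = emeasure lborel {real k / real n ..< (real k + 1) / real n}"
      by (subst emeasure_distr[OF meas]) (simp_all add: emeasure_restrict_space space_restrict_space)
    also have "\<dots> = ennreal ((real k + 1) / real n - real k / real n)"
      using n by (intro emeasure_lborel_Ico) (simp add: divide_right_mono)
    also have "(real k + 1) / real n - real k / real n = 1 / real n" by (simp add: add_divide_distrib)
    finally show "emeasure (distr ?N (count_space UNIV) ?g) {k}
        = emeasure (density (count_space UNIV) (\<lambda>_. ennreal (1 / real n))) {k}"
      by (simp add: emeasure_density)
  qed auto
  then have "(\<integral>k. f k \<partial>distr ?N (count_space UNIV) ?g) = (\<integral>k. (1 / real n) *\<^sub>R f k \<partial>count_space UNIV)"
    by (simp add: integral_density)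
  also have "\<dots> = (\<Sum>k. f k) / real n"
    using f by (simp add: integral_count_space_nat integrable_count_space_nat_iff)
  also have "(\<integral>k. f k \<partial>distr ?N (count_space UNIV) ?g) = (\<integral>x. f (?g x) \<partial>?N)"
    by (rule integral_distr[OF meas]) simp
  also have "\<dots> = (LBINT x:{0..}. f (?g x))"
    by (simp add: integral_restrict_space set_lebesgue_integral_def)
  finally show ?thesis .
qed

section \<open>Power sums of the coefficients of \<open>S_n\<close>\<close>

text \<open>The coefficient of \<open>\<epsilon> (n - k)\<close> in \<open>S_n\<close>; the summand with index \<open>j\<close> comes from \<open>X (n - j)\<close>.\<close>

definition block_coeff :: "(nat \<Rightarrow> real) \<Rightarrow> nat \<Rightarrow> nat \<Rightarrow> real" where
  "block_coeff a n k = (\<Sum>j<n. if j \<le> k then a (k - j) else 0)"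

lemma sum_lessThan_add:
  fixes f :: "nat \<Rightarrow> 'b::comm_monoid_add"
  shows "(\<Sum>i<m + n. f i) = (\<Sum>i<m. f i) + (\<Sum>i<n. f (m + i))"
  by (induction n) (simp_all add: add.assoc)

lemma block_coeff_head:
  assumes "k < n"
  shows "block_coeff a n k = (\<Sum>i<Suc k. a i)"
proof -
  have "block_coeff a n k = (\<Sum>j\<in>{..<n} \<inter> {j. j \<le> k}. a (k - j))"
    unfolding block_coeff_def by (simp add: sum.inter_restrict)
  also have "{..<n} \<inter> {j. j \<le> k} = {..<Suc k}" using assms by auto
  also have "(\<Sum>j<Suc k. a (k - j)) = (\<Sum>j<Suc k. a (Suc k - Suc j))" by simp
  also have "\<dots> = (\<Sum>j<Suc k. a j)" by (rule sum.nat_diff_reindex)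
  finally show ?thesis .
qed

lemma block_coeff_tail: "block_coeff a n (m + n) = (\<Sum>i<n. a (Suc m + i))"
proof -
  have "block_coeff a n (m + n) = (\<Sum>j<n. a (Suc m + (n - Suc j)))"
    unfolding block_coeff_def by (intro sum.cong) (auto simp: Suc_diff_Suc)
  also have "\<dots> = (\<Sum>i<n. a (Suc m + i))"
    by (rule sum.nat_diff_reindex)
  finally show ?thesis .
qed

lemma block_coeff_tail_diff:
  "block_coeff a n (m + n) = (\<Sum>i<Suc m + n. a i) - (\<Sum>i<Suc m. a i)"
  unfolding block_coeff_tail sum_lessThan_add by simp

text \<open>Passing from \<open>n\<close> to \<open>n + 1\<close> adds one shifted copy of
  \<open>a\<close>, and \<open>(x + y)^2\<close> is at most
  \<open>2 * x^2 + 2 * y^2\<close>.\<close>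

lemma summable_block_coeff_square:
  assumes a: "summable (\<lambda>i. (a i)\<^sup>2)"
  shows "summable (\<lambda>k. (block_coeff a n k)\<^sup>2)"
proof (induction n)
  case 0
  then show ?case by (simp add: block_coeff_def)
next
  case (Suc n)
  let ?s = "\<lambda>k. if n \<le> k then a (k - n) else 0"
  have "summable (\<lambda>k. (?s (k + n))\<^sup>2)" using a by simp
  then have s: "summable (\<lambda>k. (?s k)\<^sup>2)"
    by (rule summable_iff_shift[of "\<lambda>k. (?s k)\<^sup>2", THEN iffD1])
  show ?case
  proof (rule summable_comparison_test'[of "\<lambda>k. 2 * (block_coeff a n k)\<^sup>2 + 2 * (?s k)\<^sup>2" 0])
    show "summable (\<lambda>k. 2 * (block_coeff a n k)\<^sup>2 + 2 * (?s k)\<^sup>2)"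
      by (intro summable_add summable_mult Suc s)
    fix k
    have "0 \<le> (block_coeff a n k - ?s k)\<^sup>2" by (rule zero_le_power2)
    then have "(block_coeff a n k + ?s k)\<^sup>2 \<le> 2 * (block_coeff a n k)\<^sup>2 + 2 * (?s k)\<^sup>2"
      unfolding power2_sum power2_diff by linarith
    moreover have "block_coeff a (Suc n) k = block_coeff a n k + ?s k"
      by (simp add: block_coeff_def)
    ultimately show "norm ((block_coeff a (Suc n) k)\<^sup>2) \<le> 2 * (block_coeff a n k)\<^sup>2 + 2 * (?s k)\<^sup>2"
      by simp
  qed
qed

text \<open>The terms are eventually below 1 in absolute value, where higher powers are smaller than
  the square.\<close>

lemma summable_abs_power_of_square:
  fixes f :: "nat \<Rightarrow> real"
  assumes f: "summable (\<lambda>k. (f k)\<^sup>2)" and p: "p \<ge> 2"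
  shows "summable (\<lambda>k. \<bar>f k\<bar> ^ p)"
proof (rule summable_comparison_test_ev[OF _ f])
  have "\<forall>\<^sub>F k in sequentially. (f k)\<^sup>2 < 1"
    by (rule order_tendstoD[OF summable_LIMSEQ_zero[OF f]]) simp
  then show "\<forall>\<^sub>F k in sequentially. norm (\<bar>f k\<bar> ^ p) \<le> (f k)\<^sup>2"
  proof eventually_elim
    case (elim k)
    then have "\<bar>f k\<bar> \<le> 1" by (simp add: abs_square_less_1 order_less_imp_le)
    then have "\<bar>f k\<bar> ^ p \<le> \<bar>f k\<bar> ^ 2" using p by (intro power_decreasing) auto
    then show ?case by simp
  qed
qed

section \<open>Tail coefficients under long memory\<close>

lemma integrable_powr_atLeast_1:
  fixes e :: real
  assumes "e < -1"
  shows "integrable lborel (\<lambda>x. indicator {1..} x * x powr e)"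
proof -
  have "(\<lambda>x. x powr e) integrable_on {1..}"
    using has_integral_powr_to_inf[OF assms, of 1] by (auto simp: integrable_on_def)
  then have "(\<lambda>x. x powr e) absolutely_integrable_on {1..}"
    by (intro nonnegative_absolutely_integrable_1) auto
  then show ?thesis
    by (simp add: set_integrable_def integrable_completion)
qed

text \<open>The normalised tail sum is the integral of the step function \<open>b n x ^ p\<close>,
  where the index is the floor of \<open>n * x\<close>. The partial sums grow like
  \<open>(c / d) * n powr d\<close>, which gives the pointwise limit; an \<open>n\<close>-free
  envelope allows dominated convergence.\<close>

lemma long_memory_block_coeff_tail:
  fixes a :: "nat \<Rightarrow> real"
  assumes d: "0 < d" "d < 1/2" and p: "p \<ge> 2"
    and lim: "(\<lambda>k. a k / real k powr (d - 1)) \<longlonglongrightarrow> c"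
    and sq: "summable (\<lambda>i. (a i)\<^sup>2)"
  shows "(\<lambda>n. (\<Sum>m. block_coeff a n (m + n) ^ p) / real n powr (1 + real p * d))
     \<longlonglongrightarrow> (c / d) ^ p * (LBINT x:{0..}. ((1 + x) powr d - x powr d) ^ p)"
proof -
  define A where "A n = (\<Sum>i<n. a i)" for n
  have A_lim: "(\<lambda>n. A n / real n powr d) \<longlonglongrightarrow> c / d"
    using sum_asymp_powr[OF _ lim] d by (simp add: A_def)
  obtain K1 where K1: "K1 > 0" "\<And>n. norm (A n / real n powr d) \<le> K1"
    using convergent_imp_Bseq[OF convergentI[OF A_lim]] unfolding Bseq_def by blast
  obtain K2 where K2: "K2 > 0" "\<And>n. norm (a n / real n powr (d - 1)) \<le> K2"
    using convergent_imp_Bseq[OF convergentI[OF lim]] unfolding Bseq_def by blast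
  \<comment> \<open>The case \<open>n = 0\<close> is separate: division by zero makes
    \<open>K1(2)\<close> void there, but \<open>A 0 = 0\<close>.\<close>
  have A_le: "\<bar>A n\<bar> \<le> K1 * real n powr d" for n
    using K1(2)[of n] by (cases "n = 0") (auto simp: A_def field_simps)
  have a_le: "\<bar>a n\<bar> \<le> K2 * real n powr (d - 1)" if "n > 0" for n
    using K2(2)[of n] that by (auto simp: field_simps)
  \<comment> \<open>\<open>6 * K1\<close> serves \<open>x < 1\<close>, where two partial sums of at
    most \<open>3 * n\<close> terms are each at most \<open>3 * K1 * n powr d\<close>;
    \<open>K2\<close> serves \<open>x \<ge> 1\<close>.\<close>
  define K where "K = 6 * K1 + K2"
  have K: "K > 0" "6 * K1 \<le> K" "K2 \<le> K" using K1(1) K2(1) by (auto simp: K_def)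
  define m where "m n x = nat \<lfloor>real n * x\<rfloor>" for n and x :: real
  define b where "b n x = block_coeff a n (m n x + n) / real n powr d" for n x
  \<comment> \<open>For \<open>x \<ge> 1\<close> the window consists of \<open>n\<close>
    coefficients, each at most \<open>K2 * (n * x) powr (d - 1)\<close>. Near 0 that bound has a
    non-integrable \<open>p\<close>-th power, so the constant bound from the partial sums replaces
    it.\<close>
  define H where "H x = (if x < 1 then 1 else x powr (d - 1))" for x :: real
  have H: "0 \<le> H x" "H x \<le> 1" for x
    using d by (auto simp: H_def powr_le1 intro: powr_mono2'[of "d - 1" 1 x, simplified])
  have b_le: "\<bar>b n x\<bar> \<le> K * H x" if x: "x \<ge> 0" for n x
  proof (cases "n = 0")
    case True
    then show ?thesis using K H[of x] by (simp add: b_def block_coeff_def)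
  next
    case False
    then have n: "n > 0" by simp
    then have npos: "real n powr d > 0" by simp
    have nx: "0 \<le> real n * x" using x by simp
    show ?thesis
    proof (cases "x < 1")
      case True
      have "real n * x \<le> real n * 1" using True by (intro mult_left_mono) auto
      then have mn: "m n x \<le> n" unfolding m_def using nx by linarith
      have A_le': "\<bar>A j\<bar> \<le> 3 * K1 * real n powr d" if "j \<le> 3 * n" for j
      proof -
        have "\<bar>A j\<bar> \<le> K1 * real j powr d" by (rule A_le)
        also have "real j powr d \<le> (3 * real n) powr d"
          using that d by (intro powr_mono2) auto
        also have "\<dots> = 3 powr d * real n powr d" by (simp add: powr_mult)
        also have "3 powr d \<le> (3::real) powr 1" using d by (intro powr_mono) auto
        finally show ?thesis using K1(1) by (simp add: mult_left_mono mult_right_mono algebra_simps)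
      qed
      have "\<bar>block_coeff a n (m n x + n)\<bar> = \<bar>A (Suc (m n x) + n) - A (Suc (m n x))\<bar>"
        unfolding block_coeff_tail_diff A_def ..
      also have "\<dots> \<le> 3 * K1 * real n powr d + 3 * K1 * real n powr d"
        using A_le'[of "Suc (m n x) + n"] A_le'[of "Suc (m n x)"] mn n by linarith
      also have "\<dots> = 6 * K1 * real n powr d" by simp
      also have "\<dots> \<le> K * real n powr d" using K by (intro mult_right_mono) auto
      finally show ?thesis using True npos by (simp add: b_def H_def field_simps)
    next
      case False
      have "\<bar>block_coeff a n (m n x + n)\<bar> \<le> (\<Sum>i<n. \<bar>a (Suc (m n x) + i)\<bar>)"
        unfolding block_coeff_tail by (rule sum_abs)
      also have "\<dots> \<le> (\<Sum>i<n. K2 * (real n * x) powr (d - 1))"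
      proof (intro sum_mono)
        fix i
        have "\<bar>a (Suc (m n x) + i)\<bar> \<le> K2 * real (Suc (m n x) + i) powr (d - 1)"
          by (rule a_le) simp
        also have "real (Suc (m n x) + i) powr (d - 1) \<le> (real n * x) powr (d - 1)"
        proof (rule powr_mono2')
          show "real n * x \<le> real (Suc (m n x) + i)" unfolding m_def using nx by linarith
        qed (use d n False in auto)
        finally show "\<bar>a (Suc (m n x) + i)\<bar> \<le> K2 * (real n * x) powr (d - 1)"
          using K2(1) by (simp add: mult_left_mono)
      qed
      also have "\<dots> = K2 * (real n * (real n powr (d - 1))) * x powr (d - 1)"
        using x by (simp add: powr_mult)
      also have "real n * (real n powr (d - 1)) = real n powr d"
        using n by (simp add: powr_mult_base)
      also have "K2 * real n powr d * x powr (d - 1) \<le> K * real n powr d * x powr (d - 1)"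
        using K by (intro mult_right_mono) auto
      finally show ?thesis using False npos by (simp add: b_def H_def field_simps)
    qed
  qed
  define w where "w x = K ^ p * (indicator {0..<1} x + indicator {1..} x * x powr (2 * (d - 1)))" for x :: real
  have w: "integrable lborel w"
    unfolding w_def using d
    by (intro integrable_mult_right Bochner_Integration.integrable_add integrable_powr_atLeast_1) auto
  have bp_le: "\<bar>b n x ^ p\<bar> \<le> w x" if x: "x \<ge> 0" for n x
  proof -
    have "\<bar>b n x ^ p\<bar> \<le> (K * H x) ^ p"
      unfolding power_abs by (intro power_mono b_le x) auto
    also have "\<dots> = K ^ p * H x ^ p" by (rule power_mult_distrib)
    \<comment> \<open>As \<open>H\<close> is at most 1, exponent 2 is the worst case. Its tail
      exponent \<open>2 * (d - 1)\<close> is below -1 precisely because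
      \<open>d < 1/2\<close>.\<close>
    also have "H x ^ p \<le> H x ^ 2" using p H by (intro power_decreasing) auto
    also have "H x ^ 2 = indicator {0..<1} x + indicator {1..} x * x powr (2 * (d - 1))"
      using x by (auto simp: H_def powr_power)
    finally show ?thesis using K by (simp add: w_def mult_left_mono)
  qed
  have [measurable]: "m n \<in> measurable borel (count_space UNIV)" for n
    unfolding m_def by measurable
  have "(\<lambda>n. LBINT x:{0..}. b n x ^ p) \<longlonglongrightarrow> (LBINT x:{0..}. (c / d * ((1 + x) powr d - x powr d)) ^ p)"
    unfolding set_lebesgue_integral_def
  proof (rule integral_dominated_convergence[OF _ _ w])
    show "(\<lambda>x. indicator {0..} x *\<^sub>R b n x ^ p) \<in> borel_measurable lborel" for n
      unfolding b_def by measurable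
    show "AE x in lborel. norm (indicator {0..} x *\<^sub>R b n x ^ p) \<le> w x" for n
    proof (intro always_eventually allI)
      fix x :: real
      have "0 \<le> w x" using K by (simp add: w_def)
      then show "norm (indicator {0..} x *\<^sub>R b n x ^ p) \<le> w x"
        using bp_le[of x n] by (auto simp: indicator_def)
    qed
    show "AE x in lborel. (\<lambda>n. indicator {0..} x *\<^sub>R b n x ^ p)
        \<longlonglongrightarrow> indicator {0..} x *\<^sub>R (c / d * ((1 + x) powr d - x powr d)) ^ p"
      \<comment> \<open>The point \<open>x = 0\<close> is discarded because
        \<open>asymp_powr_compose\<close> needs a positive limit ratio.\<close>
      using AE_lborel_singleton[of "0::real"]
    proof eventually_elim
      case (elim x)
      show ?case
      proof (cases "x > 0")
        case True
        have m_lim: "(\<lambda>n. real (m n x) / real n) \<longlonglongrightarrow> x"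
          unfolding m_def using True by (intro floor_mult_asymp) auto
        have inv: "(\<lambda>n. 1 / real n) \<longlonglongrightarrow> 0" by real_asymp
        have "(\<lambda>n. real (m n x) / real n + 1 / real n) \<longlonglongrightarrow> x + 0"
          by (intro tendsto_add m_lim inv)
        then have m1: "(\<lambda>n. real (Suc (m n x)) / real n) \<longlonglongrightarrow> x"
          by (simp add: add_divide_distrib add.commute)
        have "(\<lambda>n. real (Suc (m n x)) / real n + 1) \<longlonglongrightarrow> x + 1"
          by (intro tendsto_add m1 tendsto_const)
        moreover have "\<forall>\<^sub>F n in sequentially. real (Suc (m n x)) / real n + 1 = real (Suc (m n x) + n) / real n"
          using eventually_gt_at_top[of 0] by eventually_elim (simp add: add_divide_distrib)
        ultimately have m2: "(\<lambda>n. real (Suc (m n x) + n) / real n) \<longlonglongrightarrow> x + 1"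
          by (rule Lim_transform_eventually)
        have "(\<lambda>n. A (Suc (m n x) + n) / real n powr d - A (Suc (m n x)) / real n powr d)
            \<longlonglongrightarrow> c / d * (x + 1) powr d - c / d * x powr d"
          using True by (intro tendsto_diff asymp_powr_compose[OF A_lim] m1 m2) auto
        then have "(\<lambda>n. b n x) \<longlonglongrightarrow> c / d * ((1 + x) powr d - x powr d)"
          unfolding b_def block_coeff_tail_diff A_def
          by (simp add: diff_divide_distrib right_diff_distrib add.commute)
        then show ?thesis by (intro tendsto_scaleR tendsto_power tendsto_const)
      next
        case False
        then show ?thesis using elim by simp
      qed
    qed
  qed measurable
  moreover have "(LBINT x:{0..}. (c / d * ((1 + x) powr d - x powr d)) ^ p)
      = (c / d) ^ p * (LBINT x:{0..}. ((1 + x) powr d - x powr d) ^ p)"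
    unfolding set_lebesgue_integral_def
    by (subst integral_mult_right_zero[symmetric]) (simp only: power_mult_distrib real_scaleR_def ac_simps)
  moreover have "\<forall>\<^sub>F n in sequentially. (LBINT x:{0..}. b n x ^ p)
      = (\<Sum>m. block_coeff a n (m + n) ^ p) / real n powr (1 + real p * d)"
    using eventually_gt_at_top[of 0]
  proof eventually_elim
    case (elim n)
    have "summable (\<lambda>k. \<bar>block_coeff a n k\<bar> ^ p)"
      by (intro summable_abs_power_of_square summable_block_coeff_square sq p)
    then have s: "summable (\<lambda>k. \<bar>block_coeff a n (k + n)\<bar> ^ p)"
      by (rule summable_ignore_initial_segment)
    then have s': "summable (\<lambda>k. block_coeff a n (k + n) ^ p)"
      by (intro summable_rabs_cancel[of "\<lambda>k. block_coeff a n (k + n) ^ p"]) (simp add: power_abs)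
    have "summable (\<lambda>k. \<bar>(block_coeff a n (k + n) / real n powr d) ^ p\<bar>)"
      using summable_divide[OF s, of "(real n powr d) ^ p"] by (simp add: power_divide power_abs abs_divide)
    from integral_floor_step[OF this elim]
    have "(LBINT x:{0..}. b n x ^ p) = (\<Sum>k. (block_coeff a n (k + n) / real n powr d) ^ p) / real n"
      unfolding b_def m_def .
    also have "\<dots> = (\<Sum>k. block_coeff a n (k + n) ^ p) / ((real n powr d) ^ p * real n)"
      using suminf_divide[OF s', of "(real n powr d) ^ p"] by (simp add: power_divide)
    \<comment> \<open>The additional factor \<open>n\<close> in the normalisation is the mesh width
      \<open>1 / n\<close> of the step function.\<close>
    also have "(real n powr d) ^ p * real n = real n powr (1 + real p * d)"
      using elim by (simp add: powr_power powr_add)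
    finally show ?case .
  qed
  ultimately show ?thesis
    by (simp only: Lim_transform_eventually)
qed

text \<open>
  With \<open>R m = (\<Sum>i. \<bar>a (i + m)\<bar>)\<close>, the tail coefficients are at most \<open>R (m + 1) - R (m + n + 1)\<close>. Their sum
  telescopes to at most \<open>R 1 + \<dots> + R n\<close>, which is \<open>o(n)\<close> since \<open>R\<close> tends to 0.
\<close>

lemma short_memory_block_coeff_tail:
  fixes a :: "nat \<Rightarrow> real"
  assumes a: "summable (\<lambda>i. \<bar>a i\<bar>)" and p: "p \<ge> 1"
  shows "(\<lambda>n. (\<Sum>m. block_coeff a n (m + n) ^ p) / real n) \<longlonglongrightarrow> 0"
proof -
  define R where "R m = (\<Sum>i. \<bar>a (i + m)\<bar>)" for m
  define K where "K = R 0"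
  have sa: "summable (\<lambda>i. \<bar>a (i + m)\<bar>)" for m
    using a by (rule summable_ignore_initial_segment)
  have R0: "R m \<ge> 0" for m
    unfolding R_def using sa by (intro suminf_nonneg) auto
  have R_split: "R m = R (m + n) + (\<Sum>i<n. \<bar>a (m + i)\<bar>)" for m n
    using suminf_split_initial_segment[OF sa[of m], of n] by (simp add: R_def ac_simps)
  have R_lim: "R \<longlonglongrightarrow> 0"
    unfolding R_def using suminf_exist_split2[OF a] by simp
  have b_le: "\<bar>block_coeff a n (m + n)\<bar> \<le> R (Suc m) - R (Suc m + n)" for n m
    unfolding block_coeff_tail using R_split[of "Suc m" n] sum_abs[of "\<lambda>i. a (Suc m + i)" "{..<n}"] by linarith
  have R_le: "R (Suc m) \<le> K" for m
    unfolding K_def using R_split[of 0 "Suc m"] sum_nonneg[of "{..<Suc m}" "\<lambda>i. \<bar>a (0 + i)\<bar>"] by simp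
  have K0: "K \<ge> 0" unfolding K_def by (rule R0)
  \<comment> \<open>All coefficients are bounded by \<open>K\<close>, which reduces the
    \<open>p\<close>-th powers to first powers.\<close>
  have bp_le: "\<bar>block_coeff a n (m + n) ^ p\<bar> \<le> K ^ (p - 1) * \<bar>block_coeff a n (m + n)\<bar>" for n m
  proof -
    have "\<bar>block_coeff a n (m + n)\<bar> \<le> K"
      using b_le[of n m] R_le[of m] R0[of "Suc m + n"] by linarith
    then have "\<bar>block_coeff a n (m + n)\<bar> ^ (p - 1) \<le> K ^ (p - 1)"
      by (intro power_mono) auto
    then have "\<bar>block_coeff a n (m + n)\<bar> ^ (p - 1) * \<bar>block_coeff a n (m + n)\<bar>
        \<le> K ^ (p - 1) * \<bar>block_coeff a n (m + n)\<bar>"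
      by (intro mult_right_mono) auto
    moreover have "\<bar>block_coeff a n (m + n) ^ p\<bar>
        = \<bar>block_coeff a n (m + n)\<bar> ^ (p - 1) * \<bar>block_coeff a n (m + n)\<bar>"
      using p by (cases p) (simp_all add: power_abs abs_mult mult.commute)
    ultimately show ?thesis by simp
  qed
  have partial: "(\<Sum>m<N. \<bar>block_coeff a n (m + n)\<bar>) \<le> (\<Sum>m<n. R (Suc m))" for n N
  proof -
    have "(\<Sum>m<N. \<bar>block_coeff a n (m + n)\<bar>) \<le> (\<Sum>m<N. R (Suc m)) - (\<Sum>m<N. R (Suc m + n))"
      unfolding sum_subtractf[symmetric] by (intro sum_mono b_le)
    also have "(\<Sum>m<N. R (Suc m)) \<le> (\<Sum>m<n + N. R (Suc m))"
      using R0 by (intro sum_mono2) auto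
    also have "\<dots> = (\<Sum>m<n. R (Suc m)) + (\<Sum>m<N. R (Suc m + n))"
      unfolding sum_lessThan_add by (simp add: add.commute[of n])
    finally show ?thesis by simp
  qed
  have sb: "summable (\<lambda>m. \<bar>block_coeff a n (m + n)\<bar>)" for n
    by (rule bounded_imp_summable[where B = "\<Sum>m<n. R (Suc m)"])
       (use partial[of n] in \<open>auto simp del: sum.lessThan_Suc simp flip: lessThan_Suc_atMost\<close>)
  \<comment> \<open>The exponent is left as \<open>0 + 1\<close> to match
    \<open>sum_asymp_powr\<close> with \<open>q = 0\<close>.\<close>
  have le: "norm ((\<Sum>m. block_coeff a n (m + n) ^ p) / real n)
      \<le> K ^ (p - 1) * ((\<Sum>m<n. R (Suc m)) / real n powr (0 + 1))" for n
  proof -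
    have s1: "summable (\<lambda>m. \<bar>block_coeff a n (m + n) ^ p\<bar>)"
      using bp_le by (intro summable_comparison_test'[OF summable_mult[OF sb[of n], of "K ^ (p - 1)"], of 0]) auto
    have "\<bar>\<Sum>m. block_coeff a n (m + n) ^ p\<bar> \<le> (\<Sum>m. \<bar>block_coeff a n (m + n) ^ p\<bar>)"
      by (rule summable_rabs[OF s1])
    also have "\<dots> \<le> (\<Sum>m. K ^ (p - 1) * \<bar>block_coeff a n (m + n)\<bar>)"
      by (intro suminf_le bp_le s1 summable_mult sb)
    also have "\<dots> = K ^ (p - 1) * (\<Sum>m. \<bar>block_coeff a n (m + n)\<bar>)"
      by (rule suminf_mult[OF sb])
    also have "\<dots> \<le> K ^ (p - 1) * (\<Sum>m<n. R (Suc m))"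
      using K0 by (intro mult_left_mono suminf_le_const sb partial) auto
    finally show ?thesis by (simp add: divide_right_mono)
  qed
  have "(\<lambda>k. R (Suc k)) \<longlonglongrightarrow> 0" using R_lim by (rule LIMSEQ_Suc)
  then have "(\<lambda>k. R (Suc k) / real k powr 0) \<longlonglongrightarrow> 0"
  \<comment> \<open>Only an eventual equality, because \<open>0 powr 0 = 0\<close>.\<close>
  proof (rule Lim_transform_eventually)
    show "\<forall>\<^sub>F k in sequentially. R (Suc k) = R (Suc k) / real k powr 0"
      using eventually_gt_at_top[of 0] by eventually_elim simp
  qed
  from sum_asymp_powr[OF _ this]
  have "(\<lambda>n. K ^ (p - 1) * ((\<Sum>m<n. R (Suc m)) / real n powr (0 + 1))) \<longlonglongrightarrow> 0"
    by (intro tendsto_mult_right_zero) simp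
  then show ?thesis
    by (rule Lim_null_comparison[OF always_eventually[OF allI[OF le]]])
qed

text \<open>For \<open>k < n\<close> the coefficients are partial sums of \<open>a\<close>, so their
  \<open>p\<close>-th powers are asymptotic to \<open>C ^ p * k powr (p * d)\<close>; summing these
  powers gives the factor \<open>1 / (1 + p * d)\<close>.\<close>

lemma block_coeff_head_asymp:
  fixes a :: "nat \<Rightarrow> real"
  assumes d: "d \<ge> 0" and A: "(\<lambda>n. (\<Sum>i<n. a i) / real n powr d) \<longlonglongrightarrow> C"
  shows "(\<lambda>n. (\<Sum>k<n. block_coeff a n k ^ p) / real n powr (1 + real p * d)) \<longlonglongrightarrow> C ^ p / (1 + real p * d)"
proof -
  have "(\<lambda>n. real (Suc n) / real n) \<longlonglongrightarrow> 1" by real_asymp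
  \<comment> \<open>The head coefficient has \<open>Suc k\<close> summands; the shift by one is the
    case \<open>y = 1\<close> of \<open>asymp_powr_compose\<close>.\<close>
  then have "(\<lambda>n. (\<Sum>i<Suc n. a i) / real n powr d) \<longlonglongrightarrow> C * 1 powr d"
    by (intro asymp_powr_compose[OF A]) auto
  then have "(\<lambda>n. ((\<Sum>i<Suc n. a i) / real n powr d) ^ p) \<longlonglongrightarrow> C ^ p"
    by (intro tendsto_power) simp
  then have "(\<lambda>n. (\<Sum>i<Suc n. a i) ^ p / real n powr (real p * d)) \<longlonglongrightarrow> C ^ p"
  proof (rule Lim_transform_eventually)
    show "\<forall>\<^sub>F n in sequentially. ((\<Sum>i<Suc n. a i) / real n powr d) ^ p
        = (\<Sum>i<Suc n. a i) ^ p / real n powr (real p * d)"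
      using eventually_gt_at_top[of 0] by eventually_elim (simp add: power_divide powr_power)
  qed
  from sum_asymp_powr[OF _ this]
  have "(\<lambda>n. (\<Sum>k<n. (\<Sum>i<Suc k. a i) ^ p) / real n powr (real p * d + 1)) \<longlonglongrightarrow> C ^ p / (real p * d + 1)"
    using d by (simp add: add_nonneg_pos order_less_le_trans[of "-1" 0])
  then show ?thesis
    by (simp add: block_coeff_head add.commute del: sum.lessThan_Suc)
qed

text \<open>Head and tail are added. One \<open>C\<close> serves all \<open>p\<close>: the sum of
  the coefficients if \<open>d = 0\<close>, and \<open>c / d\<close> under long memory. Its
  positivity makes \<open>C ^ 3 / (C ^ 2) powr (3/2)\<close> equal to 1 rather than -1.\<close>

lemma block_coeff_power_sum_asymp:
  fixes a :: "nat \<Rightarrow> real"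
  assumes d: "0 \<le> d" "d < 1/2" and mem: "has_memory d a" and sq: "summable (\<lambda>i. (a i)\<^sup>2)"
    and pos: "d = 0 \<Longrightarrow> (\<Sum>i. a i) > 0"
  obtains C where "C > 0"
    and "\<And>p. p \<ge> 2 \<Longrightarrow> (\<lambda>n. (\<Sum>k. block_coeff a n k ^ p) / real n powr (1 + real p * d))
      \<longlonglongrightarrow> C ^ p * (1 / (1 + real p * d) + (LBINT x:{0..}. ((1 + x) powr d - x powr d) ^ p))"
proof -
  obtain C where C: "C > 0" and A: "(\<lambda>n. (\<Sum>i<n. a i) / real n powr d) \<longlonglongrightarrow> C"
    and tail: "\<And>p. p \<ge> 2 \<Longrightarrow> (\<lambda>n. (\<Sum>m. block_coeff a n (m + n) ^ p) / real n powr (1 + real p * d))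
      \<longlonglongrightarrow> C ^ p * (LBINT x:{0..}. ((1 + x) powr d - x powr d) ^ p)"
  proof (cases "d = 0")
    case True
    have sa: "summable (\<lambda>i. \<bar>a i\<bar>)" using mem True by (simp add: has_memory_def short_memory_def)
    have "(\<lambda>n. \<Sum>i<n. a i) \<longlonglongrightarrow> (\<Sum>i. a i)"
      using summable_LIMSEQ[OF summable_rabs_cancel[OF sa]] .
    then have 1: "(\<lambda>n. (\<Sum>i<n. a i) / real n powr d) \<longlonglongrightarrow> (\<Sum>i. a i)"
    proof (rule Lim_transform_eventually)
      show "\<forall>\<^sub>F n in sequentially. (\<Sum>i<n. a i) = (\<Sum>i<n. a i) / real n powr d"
        using eventually_gt_at_top[of 0] by eventually_elim (simp add: True)
    qed
    have 2: "(\<lambda>n. (\<Sum>m. block_coeff a n (m + n) ^ p) / real n powr (1 + real p * d))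
      \<longlonglongrightarrow> (\<Sum>i. a i) ^ p * (LBINT x:{0..}. ((1 + x) powr d - x powr d) ^ p)" if "p \<ge> 2" for p
    proof -
      have "(LBINT x:{0..}. ((1 + x) powr d - x powr d) ^ p) = 0"
        unfolding set_lebesgue_integral_def
      proof (rule integral_eq_zero_AE)
        show "AE x in lborel. indicator {0..} x *\<^sub>R ((1 + x) powr d - x powr d) ^ p = 0"
          using AE_lborel_singleton[of "0::real"]
          by eventually_elim (use True that in \<open>auto simp: indicator_def\<close>)
      qed
      then show ?thesis
        using short_memory_block_coeff_tail[OF sa, of p] that True by simp
    qed
    show thesis by (rule that[OF pos[OF True] 1 2])
  next
    case False
    then have d0: "d > 0" using d by simp
    obtain c where c: "c > 0" and "a \<sim>[at_top] (\<lambda>i. c * real i powr (d - 1))"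
      using mem False by (auto simp: has_memory_def long_memory_def)
    then have "(\<lambda>i. if a i = 0 \<and> c * real i powr (d - 1) = 0 then 1 else a i / (c * real i powr (d - 1))) \<longlonglongrightarrow> 1"
      by (simp add: asymp_equiv_def)
    then have "(\<lambda>i. c * (if a i = 0 \<and> c * real i powr (d - 1) = 0 then 1 else a i / (c * real i powr (d - 1)))) \<longlonglongrightarrow> c * 1"
      by (intro tendsto_mult tendsto_const)
    \<comment> \<open>The conditional is the 0/0 convention of \<open>asymp_equiv\<close>; it is
      inactive for \<open>i > 0\<close>, where the comparison function is positive.\<close>
    moreover have "\<forall>\<^sub>F i in sequentially. c * (if a i = 0 \<and> c * real i powr (d - 1) = 0 then 1
        else a i / (c * real i powr (d - 1))) = a i / real i powr (d - 1)"
      using eventually_gt_at_top[of 0] by eventually_elim (use c in auto)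
    ultimately have lim: "(\<lambda>i. a i / real i powr (d - 1)) \<longlonglongrightarrow> c"
      by (auto intro: Lim_transform_eventually)
    have 1: "(\<lambda>n. (\<Sum>i<n. a i) / real n powr d) \<longlonglongrightarrow> c / d"
      using sum_asymp_powr[OF _ lim] d0 by simp
    show thesis
      by (rule that[OF _ 1 long_memory_block_coeff_tail[OF d0 d(2) _ lim sq]]) (use c d0 in auto)
  qed
  show thesis
  proof (rule that[OF C])
    fix p :: nat assume p: "p \<ge> 2"
    have "summable (\<lambda>k. block_coeff a n k ^ p)" for n
      using summable_abs_power_of_square[OF summable_block_coeff_square[OF sq] p, of n]
      by (intro summable_rabs_cancel[of "\<lambda>k. block_coeff a n k ^ p"]) (simp add: power_abs)
    then have "(\<Sum>k. block_coeff a n k ^ p) = (\<Sum>m. block_coeff a n (m + n) ^ p) + (\<Sum>k<n. block_coeff a n k ^ p)" for n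
      by (rule suminf_split_initial_segment)
    moreover have "(\<lambda>n. (\<Sum>m. block_coeff a n (m + n) ^ p) / real n powr (1 + real p * d)
          + (\<Sum>k<n. block_coeff a n k ^ p) / real n powr (1 + real p * d))
        \<longlonglongrightarrow> C ^ p * (LBINT x:{0..}. ((1 + x) powr d - x powr d) ^ p) + C ^ p / (1 + real p * d)"
      by (intro tendsto_add tail p block_coeff_head_asymp d(1) A)
    ultimately show "(\<lambda>n. (\<Sum>k. block_coeff a n k ^ p) / real n powr (1 + real p * d))
      \<longlonglongrightarrow> C ^ p * (1 / (1 + real p * d) + (LBINT x:{0..}. ((1 + x) powr d - x powr d) ^ p))"
      by (simp add: add_divide_distrib distrib_left add.commute)
  qed
qed

section \<open>Moments of series of independent centred variables\<close>

text \<open>Dominated convergence with a majorant that may depend on \<open>n\<close>, provided its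
  excess over \<open>g\<close> vanishes in mean. It will be used for powers of partial sums
  \<open>T n\<close> of a random series with limit \<open>S\<close>, so no integrable bound on the
  supremum of \<open>T n\<close> over \<open>n\<close> is required.\<close>

lemma integral_tendsto_dominated_up_to_L1:
  fixes f h :: "nat \<Rightarrow> 'a \<Rightarrow> real" and F g :: "'a \<Rightarrow> real"
  assumes [measurable]: "\<And>n. f n \<in> borel_measurable M" "F \<in> borel_measurable M"
    and lim: "AE x in M. (\<lambda>n. f n x) \<longlonglongrightarrow> F x"
    and f_le: "\<And>n x. \<bar>f n x\<bar> \<le> g x + h n x"
    and F_le: "\<And>x. \<bar>F x\<bar> \<le> g x"
    and g: "integrable M g"
    and h: "\<And>n. integrable M (h n)" "\<And>n x. h n x \<ge> 0" "(\<lambda>n. \<integral>x. h n x \<partial>M) \<longlonglongrightarrow> 0"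
  shows "(\<lambda>n. \<integral>x. f n x \<partial>M) \<longlonglongrightarrow> (\<integral>x. F x \<partial>M)"
proof -
  have [measurable]: "g \<in> borel_measurable M" "\<And>n. h n \<in> borel_measurable M"
    using g h(1) by auto
  \<comment> \<open>Truncating \<open>f n\<close> at \<open>g\<close> costs at most \<open>h n\<close>, and the truncation is dominated by \<open>g\<close>.\<close>
  define c where "c n x = max (- g x) (min (g x) (f n x))" for n x
  have g0: "g x \<ge> 0" for x using F_le[of x] by linarith
  have [measurable]: "c n \<in> borel_measurable M" for n unfolding c_def by measurable
  have c_le: "\<bar>c n x\<bar> \<le> g x" for n x using g0[of x] unfolding c_def by auto
  have fc_le: "\<bar>f n x - c n x\<bar> \<le> h n x" for n x
    using g0[of x] f_le[of n x] h(2)[of n x] unfolding c_def by auto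
  have "(\<lambda>n. \<integral>x. c n x \<partial>M) \<longlonglongrightarrow> (\<integral>x. F x \<partial>M)"
  proof (rule integral_dominated_convergence[where w = g])
    show "AE x in M. (\<lambda>n. c n x) \<longlonglongrightarrow> F x"
      using lim
    proof eventually_elim
      case (elim x)
      have "(\<lambda>n. c n x) \<longlonglongrightarrow> max (- g x) (min (g x) (F x))"
        unfolding c_def by (intro tendsto_max tendsto_min tendsto_const elim)
      also have "max (- g x) (min (g x) (F x)) = F x" using F_le[of x] by auto
      finally show ?case .
    qed
  qed (use g c_le in auto)
  moreover have "(\<lambda>n. (\<integral>x. f n x \<partial>M) - (\<integral>x. c n x \<partial>M)) \<longlonglongrightarrow> 0"
  proof (rule Lim_null_comparison[OF _ h(3)], intro always_eventually allI)
    fix n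
    have ic: "integrable M (c n)"
      by (rule Bochner_Integration.integrable_bound[OF g]) (use c_le g0 in auto)
    have "integrable M (f n)"
      by (rule Bochner_Integration.integrable_bound[OF Bochner_Integration.integrable_add[OF g h(1)[of n]]])
         (use f_le g0 h(2) in \<open>auto simp: abs_of_nonneg\<close>)
    then have "norm ((\<integral>x. f n x \<partial>M) - (\<integral>x. c n x \<partial>M)) = \<bar>\<integral>x. f n x - c n x \<partial>M\<bar>"
      using ic by simp
    also have "\<dots> \<le> (\<integral>x. \<bar>f n x - c n x\<bar> \<partial>M)" by (rule integral_abs_bound)
    also have "\<dots> \<le> (\<integral>x. h n x \<partial>M)"
      by (rule integral_mono_AE') (use h fc_le in auto)
    finally show "norm ((\<integral>x. f n x \<partial>M) - (\<integral>x. c n x \<partial>M)) \<le> (\<integral>x. h n x \<partial>M)" .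
  qed
  ultimately have "(\<lambda>n. ((\<integral>x. f n x \<partial>M) - (\<integral>x. c n x \<partial>M)) + (\<integral>x. c n x \<partial>M)) \<longlonglongrightarrow> 0 + (\<integral>x. F x \<partial>M)"
    by (intro tendsto_add)
  then show ?thesis by simp
qed

text \<open>
  The second term is linear in \<open>y\<close>, so its expectation vanishes for centred independent \<open>y\<close>.
\<close>

lemma abs_add_cubed_le:
  fixes x y :: real
  shows "\<bar>x + y\<bar> ^ 3 \<le> \<bar>x\<bar> ^ 3 + 3 * (\<bar>x\<bar> * x) * y + 3 * \<bar>x\<bar> * y\<^sup>2 + \<bar>y\<bar> ^ 3"
proof -
  have *: "\<bar>x + y\<bar> ^ 3 \<le> \<bar>x\<bar> ^ 3 + 3 * (\<bar>x\<bar> * x) * y + 3 * \<bar>x\<bar> * y\<^sup>2 + \<bar>y\<bar> ^ 3"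
    if "x \<ge> 0" for x y :: real
  proof (cases "y \<ge> 0")
    case True
    then show ?thesis using that by (simp add: power2_eq_square power3_eq_cube algebra_simps)
  next
    case neg: False
    show ?thesis
    proof (cases "x + y \<ge> 0")
      case True
      have "y ^ 3 \<le> 0" using neg by (simp add: power_less_zero_eq)
      then show ?thesis using that neg True
        by (simp add: power2_eq_square power3_eq_cube algebra_simps)
    next
      case False
      \<comment> \<open>The difference of the two sides is
        \<open>2 * x * (x^2 + 3 * x * y + 3 * y^2)\<close>; here the quadratic factor has its square
        completed.\<close>
      have "0 \<le> 2 * x * ((x + 3/2 * y)\<^sup>2 + 3/4 * y\<^sup>2)" using that by simp
      then show ?thesis using that neg False
        by (simp add: power2_eq_square power3_eq_cube algebra_simps)
    qed
  qed
  show ?thesis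
  proof (cases "x \<ge> 0")
    case True then show ?thesis by (rule *)
  next
    case False
    \<comment> \<open>Both sides are invariant under changing the signs of \<open>x\<close> and
      \<open>y\<close> together.\<close>
    then have "\<bar>- x + - y\<bar> ^ 3 \<le> \<bar>- x\<bar> ^ 3 + 3 * (\<bar>- x\<bar> * - x) * - y + 3 * \<bar>- x\<bar> * (- y)\<^sup>2 + \<bar>- y\<bar> ^ 3"
      by (intro *) auto
    moreover have "\<bar>- x + - y\<bar> = \<bar>x + y\<bar>" by linarith
    ultimately show ?thesis by simp
  qed
qed

text \<open>The right side minus the left side is \<open>3 * (u + v) * (u - v)^2\<close>.\<close>

lemma add_cubed_le:
  fixes u v :: real
  assumes "u \<ge> 0" "v \<ge> 0"
  shows "(u + v) ^ 3 \<le> 4 * u ^ 3 + 4 * v ^ 3"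
proof -
  have "0 \<le> 3 * ((u + v) * (u - v)\<^sup>2)" using assms by simp
  then show ?thesis by (simp add: power2_eq_square power3_eq_cube algebra_simps)
qed

lemma abs_power_le_one_plus_cube:
  fixes x :: real
  assumes "p \<le> 3"
  shows "\<bar>x\<bar> ^ p \<le> 1 + \<bar>x\<bar> ^ 3"
proof (cases "\<bar>x\<bar> \<le> 1")
  case True
  then have "\<bar>x\<bar> ^ p \<le> 1" by (simp add: power_le_one)
  moreover have "0 \<le> \<bar>x\<bar> ^ 3" by simp
  ultimately show ?thesis by linarith
next
  case False
  then have "\<bar>x\<bar> ^ p \<le> \<bar>x\<bar> ^ 3" using assms by (intro power_increasing) auto
  then show ?thesis by linarith
qed

lemma (in finite_measure) integrable_power_of_abs_cube:
  fixes f :: "'a \<Rightarrow> real"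
  assumes f[measurable]: "f \<in> borel_measurable M" and i: "integrable M (\<lambda>x. \<bar>f x\<bar> ^ 3)" and "p \<le> 3"
  shows "integrable M (\<lambda>x. f x ^ p)"
proof (rule Bochner_Integration.integrable_bound)
  show "integrable M (\<lambda>x. 1 + \<bar>f x\<bar> ^ 3)" using i by simp
  show "AE x in M. norm (f x ^ p) \<le> norm (1 + \<bar>f x\<bar> ^ 3)"
    using abs_power_le_one_plus_cube[OF \<open>p \<le> 3\<close>] by (auto simp: power_abs)
qed simp

text \<open>Nonnegativity of the variance of \<open>\<bar>f\<bar>\<close>.\<close>

lemma (in prob_space) expectation_abs_le_sqrt:
  fixes f :: "'a \<Rightarrow> real"
  assumes "integrable M f" "integrable M (\<lambda>x. (f x)\<^sup>2)"
  shows "expectation (\<lambda>x. \<bar>f x\<bar>) \<le> sqrt (expectation (\<lambda>x. (f x)\<^sup>2))"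
proof -
  have "0 \<le> variance (\<lambda>x. \<bar>f x\<bar>)" by (rule variance_positive)
  also have "\<dots> = expectation (\<lambda>x. (f x)\<^sup>2) - (expectation (\<lambda>x. \<bar>f x\<bar>))\<^sup>2"
    using assms by (subst variance_eq) auto
  finally show ?thesis by (simp add: real_le_rsqrt)
qed

section \<open>Moments of finite sums of independent centred variables\<close>

lemma (in prob_space) indep_var_expectation_mult:
  fixes X Y :: "'a \<Rightarrow> real" and f g :: "real \<Rightarrow> real"
  assumes indep: "indep_var borel Y borel X"
    and [measurable]: "f \<in> borel_measurable borel" "g \<in> borel_measurable borel"
    and "integrable M (\<lambda>x. f (X x))" "integrable M (\<lambda>x. g (Y x))"
  shows "integrable M (\<lambda>x. f (X x) * g (Y x))"
    and "expectation (\<lambda>x. f (X x) * g (Y x)) = expectation (\<lambda>x. f (X x)) * expectation (\<lambda>x. g (Y x))"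
proof -
  have "indep_var borel (g \<circ> Y) borel (f \<circ> X)"
    by (rule indep_var_compose[OF indep]) auto
  then have *: "indep_var borel (\<lambda>x. g (Y x)) borel (\<lambda>x. f (X x))" by (simp add: comp_def)
  show "integrable M (\<lambda>x. f (X x) * g (Y x))"
    using indep_var_integrable[OF * assms(5,4)] by (simp only: mult.commute)
  show "expectation (\<lambda>x. f (X x) * g (Y x)) = expectation (\<lambda>x. f (X x)) * expectation (\<lambda>x. g (Y x))"
    using indep_var_lebesgue_integral[OF * assms(5,4)] by (simp only: mult.commute)
qed

text \<open>Every mixed monomial in the square and the cube contains \<open>T\<close> or
  \<open>Z\<close> to the first power, so its expectation vanishes. In the absolute cube the term
  \<open>\<bar>T\<bar> * Z^2\<close> survives and is controlled by the second moment of
  \<open>T\<close>.\<close>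

lemma (in prob_space) indep_centred_add_moments:
  fixes T Z :: "'a \<Rightarrow> real"
  assumes indep: "indep_var borel Z borel T"
    and [measurable]: "T \<in> borel_measurable M" "Z \<in> borel_measurable M"
    and T3: "integrable M (\<lambda>x. \<bar>T x\<bar> ^ 3)" and Z3: "integrable M (\<lambda>x. \<bar>Z x\<bar> ^ 3)"
    and ET: "expectation T = 0" and EZ: "expectation Z = 0"
  shows "integrable M (\<lambda>x. \<bar>T x + Z x\<bar> ^ 3)"
    and "expectation (\<lambda>x. T x + Z x) = 0"
    and "expectation (\<lambda>x. (T x + Z x)\<^sup>2) = expectation (\<lambda>x. (T x)\<^sup>2) + expectation (\<lambda>x. (Z x)\<^sup>2)"
    and "expectation (\<lambda>x. (T x + Z x) ^ 3) = expectation (\<lambda>x. T x ^ 3) + expectation (\<lambda>x. Z x ^ 3)"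
    and "expectation (\<lambda>x. \<bar>T x + Z x\<bar> ^ 3) \<le> expectation (\<lambda>x. \<bar>T x\<bar> ^ 3)
           + 3 * sqrt (expectation (\<lambda>x. (T x)\<^sup>2)) * expectation (\<lambda>x. (Z x)\<^sup>2)
           + expectation (\<lambda>x. \<bar>Z x\<bar> ^ 3)"
proof -
  note iT = integrable_power_of_abs_cube[OF \<open>T \<in> borel_measurable M\<close> T3]
  note iZ = integrable_power_of_abs_cube[OF \<open>Z \<in> borel_measurable M\<close> Z3]
  have T: "integrable M T" "integrable M (\<lambda>x. (T x)\<^sup>2)" "integrable M (\<lambda>x. T x ^ 3)"
    using iT[of 1] iT[of 2] iT[of 3] by simp_all
  have Z: "integrable M Z" "integrable M (\<lambda>x. (Z x)\<^sup>2)" "integrable M (\<lambda>x. Z x ^ 3)"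
    using iZ[of 1] iZ[of 2] iZ[of 3] by simp_all
  have TT: "integrable M (\<lambda>x. \<bar>T x\<bar> * T x)"
    by (rule Bochner_Integration.integrable_bound[OF T(2)]) (auto simp: power2_eq_square abs_mult)
  note m = indep_var_expectation_mult[OF indep]
  have A: "integrable M (\<lambda>x. \<bar>T x\<bar>)" using T(1) by simp
  have m11: "integrable M (\<lambda>x. T x * Z x)" "expectation (\<lambda>x. T x * Z x) = expectation T * expectation Z"
    by (rule m[of "\<lambda>t. t" "\<lambda>t. t", OF _ _ T(1) Z(1)]; measurable)+
  have m21: "integrable M (\<lambda>x. (T x)\<^sup>2 * Z x)"
      "expectation (\<lambda>x. (T x)\<^sup>2 * Z x) = expectation (\<lambda>x. (T x)\<^sup>2) * expectation Z"
    by (rule m[of "\<lambda>t. t\<^sup>2" "\<lambda>t. t", OF _ _ T(2) Z(1)]; measurable)+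
  have m12: "integrable M (\<lambda>x. T x * (Z x)\<^sup>2)"
      "expectation (\<lambda>x. T x * (Z x)\<^sup>2) = expectation T * expectation (\<lambda>x. (Z x)\<^sup>2)"
    by (rule m[of "\<lambda>t. t" "\<lambda>t. t\<^sup>2", OF _ _ T(1) Z(2)]; measurable)+
  have mTT: "integrable M (\<lambda>x. (\<bar>T x\<bar> * T x) * Z x)"
      "expectation (\<lambda>x. (\<bar>T x\<bar> * T x) * Z x) = expectation (\<lambda>x. \<bar>T x\<bar> * T x) * expectation Z"
    by (rule m[of "\<lambda>t. \<bar>t\<bar> * t" "\<lambda>t. t", OF _ _ TT Z(1)]; measurable)+
  have mA2: "integrable M (\<lambda>x. \<bar>T x\<bar> * (Z x)\<^sup>2)"
     "expectation (\<lambda>x. \<bar>T x\<bar> * (Z x)\<^sup>2) = expectation (\<lambda>x. \<bar>T x\<bar>) * expectation (\<lambda>x. (Z x)\<^sup>2)"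
    by (rule m[of "\<lambda>t. \<bar>t\<bar>" "\<lambda>t. t\<^sup>2", OF _ _ A Z(2)]; measurable)+
  let ?u = "\<lambda>x. \<bar>T x\<bar> ^ 3 + 3 * ((\<bar>T x\<bar> * T x) * Z x) + 3 * (\<bar>T x\<bar> * (Z x)\<^sup>2) + \<bar>Z x\<bar> ^ 3"
  have u: "integrable M ?u"
    by (intro Bochner_Integration.integrable_add integrable_mult_right T3 Z3 mTT mA2)
  have le: "\<bar>T x + Z x\<bar> ^ 3 \<le> ?u x" for x
    using abs_add_cubed_le[of "T x" "Z x"] by (simp add: algebra_simps)
  show i: "integrable M (\<lambda>x. \<bar>T x + Z x\<bar> ^ 3)"
  proof (rule Bochner_Integration.integrable_bound[OF u], measurable, intro always_eventually allI)
    fix x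
    have "0 \<le> \<bar>T x + Z x\<bar> ^ 3" by simp
    then show "norm (\<bar>T x + Z x\<bar> ^ 3) \<le> norm (?u x)" using le[of x] by (simp only: real_norm_def) linarith
  qed
  show "expectation (\<lambda>x. T x + Z x) = 0" using T Z ET EZ by simp
  have "expectation (\<lambda>x. (T x + Z x)\<^sup>2) = expectation (\<lambda>x. (T x)\<^sup>2 + (2 * (T x * Z x) + (Z x)\<^sup>2))"
    by (simp add: power2_sum algebra_simps)
  then show "expectation (\<lambda>x. (T x + Z x)\<^sup>2) = expectation (\<lambda>x. (T x)\<^sup>2) + expectation (\<lambda>x. (Z x)\<^sup>2)"
    using T Z m11(1) by (simp add: m11(2) ET)
  have "expectation (\<lambda>x. (T x + Z x) ^ 3)
      = expectation (\<lambda>x. T x ^ 3 + (3 * ((T x)\<^sup>2 * Z x) + (3 * (T x * (Z x)\<^sup>2) + Z x ^ 3)))"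
    by (simp add: power2_eq_square power3_eq_cube algebra_simps)
  then show "expectation (\<lambda>x. (T x + Z x) ^ 3) = expectation (\<lambda>x. T x ^ 3) + expectation (\<lambda>x. Z x ^ 3)"
    using T Z m21(1) m12(1) by (simp add: m21(2) m12(2) ET EZ)
  have "expectation (\<lambda>x. \<bar>T x + Z x\<bar> ^ 3) \<le> expectation ?u"
    by (rule integral_mono[OF i u le])
  also have "\<dots> = expectation (\<lambda>x. \<bar>T x\<bar> ^ 3)
      + 3 * (expectation (\<lambda>x. \<bar>T x\<bar>) * expectation (\<lambda>x. (Z x)\<^sup>2)) + expectation (\<lambda>x. \<bar>Z x\<bar> ^ 3)"
    using T3 Z3 mTT(1) mA2(1) by (simp add: mTT(2) mA2(2) EZ)
  also have "\<dots> \<le> expectation (\<lambda>x. \<bar>T x\<bar> ^ 3)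
      + 3 * (sqrt (expectation (\<lambda>x. (T x)\<^sup>2)) * expectation (\<lambda>x. (Z x)\<^sup>2)) + expectation (\<lambda>x. \<bar>Z x\<bar> ^ 3)"
    by (intro add_mono mult_left_mono mult_right_mono expectation_abs_le_sqrt T) auto
  finally show "expectation (\<lambda>x. \<bar>T x + Z x\<bar> ^ 3) \<le> expectation (\<lambda>x. \<bar>T x\<bar> ^ 3)
      + 3 * sqrt (expectation (\<lambda>x. (T x)\<^sup>2)) * expectation (\<lambda>x. (Z x)\<^sup>2) + expectation (\<lambda>x. \<bar>Z x\<bar> ^ 3)"
    by simp
qed

text \<open>The claims form one conjunction because the induction step for the last one uses the
  others. That last one is the Rosenthal-type bound: it involves only sums of second and third
  absolute moments, hence is small on tails of a series.\<close>

lemma (in prob_space) indep_centred_sum_moments: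
  fixes Z :: "nat \<Rightarrow> 'a \<Rightarrow> real"
  assumes indep: "indep_vars (\<lambda>_. borel) Z UNIV"
    and Z3: "\<And>k. integrable M (\<lambda>x. \<bar>Z k x\<bar> ^ 3)"
    and EZ: "\<And>k. expectation (Z k) = 0"
  shows "integrable M (\<lambda>x. \<bar>\<Sum>k<N. Z k x\<bar> ^ 3)
    \<and> expectation (\<lambda>x. \<Sum>k<N. Z k x) = 0
    \<and> expectation (\<lambda>x. (\<Sum>k<N. Z k x)\<^sup>2) = (\<Sum>k<N. expectation (\<lambda>x. (Z k x)\<^sup>2))
    \<and> expectation (\<lambda>x. (\<Sum>k<N. Z k x) ^ 3) = (\<Sum>k<N. expectation (\<lambda>x. Z k x ^ 3))
    \<and> expectation (\<lambda>x. \<bar>\<Sum>k<N. Z k x\<bar> ^ 3)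
        \<le> 3 * sqrt (\<Sum>k<N. expectation (\<lambda>x. (Z k x)\<^sup>2)) * (\<Sum>k<N. expectation (\<lambda>x. (Z k x)\<^sup>2))
           + (\<Sum>k<N. expectation (\<lambda>x. \<bar>Z k x\<bar> ^ 3))"
proof (induction N)
  case 0
  then show ?case by simp
next
  case (Suc N)
  have [measurable]: "Z k \<in> borel_measurable M" for k
    using indep unfolding indep_vars_def by auto
  let ?T = "\<lambda>x. \<Sum>k<N. Z k x"
  define B where "B n = (\<Sum>k<n. expectation (\<lambda>x. (Z k x)\<^sup>2))" for n
  have B0: "B n \<ge> 0" for n unfolding B_def by (intro sum_nonneg) auto
  have B_mono: "B N \<le> B (Suc N)" unfolding B_def by simp
  have ind: "indep_var borel (Z N) borel ?T"
    by (rule indep_vars_sum) (auto intro: indep_vars_subset[OF indep])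
  note IH = Suc[folded B_def]
  \<comment> \<open>The new cross term is absorbed because the second moments \<open>B\<close> are
    additive and increasing.\<close>
  have "3 * sqrt (B N) * B N + 3 * sqrt (B N) * expectation (\<lambda>x. (Z N x)\<^sup>2) = 3 * sqrt (B N) * B (Suc N)"
    by (simp add: B_def algebra_simps)
  also have "\<dots> \<le> 3 * sqrt (B (Suc N)) * B (Suc N)"
    using B0 B_mono by (intro mult_right_mono mult_left_mono) auto
  finally have le: "3 * sqrt (B N) * B N + 3 * sqrt (B N) * expectation (\<lambda>x. (Z N x)\<^sup>2)
    \<le> 3 * sqrt (B (Suc N)) * B (Suc N)" .
  have T3: "integrable M (\<lambda>x. \<bar>?T x\<bar> ^ 3)" and ET: "expectation ?T = 0"
    using IH by auto
  have m: "?T \<in> borel_measurable M" by measurable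
  note step = indep_centred_add_moments[OF ind m _ T3 Z3 ET EZ]
  have "integrable M (\<lambda>x. \<bar>?T x + Z N x\<bar> ^ 3)" "expectation (\<lambda>x. ?T x + Z N x) = 0"
    by (rule step; measurable)+
  moreover have "expectation (\<lambda>x. (?T x + Z N x)\<^sup>2) = B N + expectation (\<lambda>x. (Z N x)\<^sup>2)"
    using IH step(3) by auto
  moreover have "expectation (\<lambda>x. (?T x + Z N x) ^ 3)
      = (\<Sum>k<N. expectation (\<lambda>x. Z k x ^ 3)) + expectation (\<lambda>x. Z N x ^ 3)"
    using IH step(4) by auto
  moreover have "expectation (\<lambda>x. \<bar>?T x + Z N x\<bar> ^ 3) \<le> expectation (\<lambda>x. \<bar>?T x\<bar> ^ 3)
      + 3 * sqrt (B N) * expectation (\<lambda>x. (Z N x)\<^sup>2) + expectation (\<lambda>x. \<bar>Z N x\<bar> ^ 3)"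
    using IH step(5) by auto
  moreover have "expectation (\<lambda>x. \<bar>?T x\<bar> ^ 3)
      \<le> 3 * sqrt (B N) * B N + (\<Sum>k<N. expectation (\<lambda>x. \<bar>Z k x\<bar> ^ 3))"
    using IH by auto
  ultimately show ?case
    using le unfolding B_def[symmetric] by (simp add: B_def[of "Suc N"] flip: B_def[of N])
qed

section \<open>From finite sums to almost surely convergent series\<close>

lemma (in prob_space) indep_vars_reindex:
  assumes indep: "indep_vars N X (g ` I)" and inj: "inj_on g I"
  shows "indep_vars (\<lambda>i. N (g i)) (\<lambda>i. X (g i)) I"
proof -
  define F where "F i = {X i -` A \<inter> space M |A. A \<in> sets (N i)}" for i
  have rv: "\<forall>i\<in>g ` I. random_variable (N i) (X i)" and F: "indep_sets F (g ` I)"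
    using indep unfolding indep_vars_def2 F_def by auto
  have "indep_sets (\<lambda>i. F (g i)) I"
    unfolding indep_sets_def
  proof (intro conjI ballI allI impI)
    show "F (g i) \<subseteq> events" if "i \<in> I" for i
      using F that unfolding indep_sets_def by auto
  next
    fix J A assume J: "J \<subseteq> I" "J \<noteq> {}" "finite J" and A: "A \<in> (\<Pi> j\<in>J. F (g j))"
    have injJ: "inj_on g J" using inj J inj_on_subset by blast
    \<comment> \<open>Injectivity allows the events indexed by \<open>J\<close> to be relabelled by
      \<open>g\<close> followed by its inverse, so that independence over the image of
      \<open>J\<close> applies.\<close>
    define A' where "A' i = A (inv_into J g i)" for i
    have A': "A' (g j) = A j" if "j \<in> J" for j
      using inv_into_f_f[OF injJ that] by (simp add: A'_def)
    have "prob (\<Inter>j\<in>g ` J. A' j) = (\<Prod>j\<in>g ` J. prob (A' j))"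
      by (rule indep_setsD[OF F]) (use J A A' in auto)
    then show "prob (\<Inter>j\<in>J. A j) = (\<Prod>j\<in>J. prob (A j))"
      using A' by (simp add: prod.reindex[OF injJ])
  qed
  then show ?thesis
    using rv unfolding indep_vars_def2 F_def by auto
qed

text \<open>The third absolute moment of the remainder \<open>D n\<close> is bounded by tails of the
  two convergent moment series, so the partial sums converge in \<open>L^3\<close> and their first
  three moments pass to the limit.\<close>

lemma (in prob_space) indep_centred_series_moments:
  fixes Z :: "nat \<Rightarrow> 'a \<Rightarrow> real"
  assumes indep: "indep_vars (\<lambda>_. borel) Z UNIV"
    and Z3: "\<And>k. integrable M (\<lambda>x. \<bar>Z k x\<bar> ^ 3)"
    and EZ: "\<And>k. expectation (Z k) = 0"
    and s2: "summable (\<lambda>k. expectation (\<lambda>x. (Z k x)\<^sup>2))"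
    and s3: "summable (\<lambda>k. expectation (\<lambda>x. \<bar>Z k x\<bar> ^ 3))"
    and S[measurable]: "S \<in> borel_measurable M"
    and sums: "AE x in M. (\<lambda>k. Z k x) sums S x"
  shows "expectation S = 0"
    and "expectation (\<lambda>x. (S x)\<^sup>2) = (\<Sum>k. expectation (\<lambda>x. (Z k x)\<^sup>2))"
    and "expectation (\<lambda>x. S x ^ 3) = (\<Sum>k. expectation (\<lambda>x. Z k x ^ 3))"
proof -
  have [measurable]: "Z k \<in> borel_measurable M" for k
    using indep unfolding indep_vars_def by auto
  define T where "T n x = (\<Sum>k<n. Z k x)" for n x
  have [measurable]: "T n \<in> borel_measurable M" for n unfolding T_def by measurable
  define D where "D n x = S x - T n x" for n x
  have [measurable]: "D n \<in> borel_measurable M" for n unfolding D_def by measurable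
  define B where "B n = (\<Sum>k. expectation (\<lambda>x. (Z (k + n) x)\<^sup>2))" for n
  define R where "R n = (\<Sum>k. expectation (\<lambda>x. \<bar>Z (k + n) x\<bar> ^ 3))" for n
  have B0: "B n \<ge> 0" for n
    unfolding B_def using s2 by (intro suminf_nonneg) (auto simp: summable_iff_shift[of "\<lambda>k. expectation (\<lambda>x. (Z k x)\<^sup>2)"])
  have "B \<longlonglongrightarrow> 0" "R \<longlonglongrightarrow> 0"
    unfolding B_def R_def using suminf_exist_split2[OF s2] suminf_exist_split2[OF s3] by auto
  then have "(\<lambda>n. 3 * sqrt (B n) * B n + R n) \<longlonglongrightarrow> 3 * sqrt 0 * 0 + 0"
    by (intro tendsto_intros)
  then have e_lim: "(\<lambda>n. 3 * sqrt (B n) * B n + R n) \<longlonglongrightarrow> 0" by simp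
  have moments: "integrable M (\<lambda>x. \<bar>T n x\<bar> ^ 3)" "expectation (T n) = 0"
      "expectation (\<lambda>x. (T n x)\<^sup>2) = (\<Sum>k<n. expectation (\<lambda>x. (Z k x)\<^sup>2))"
      "expectation (\<lambda>x. T n x ^ 3) = (\<Sum>k<n. expectation (\<lambda>x. Z k x ^ 3))" for n
    using indep_centred_sum_moments[OF indep Z3 EZ, of n] by (simp_all add: T_def[abs_def])
  have T_lim: "AE x in M. (\<lambda>n. T n x) \<longlonglongrightarrow> S x"
    using sums by eventually_elim (simp add: sums_def T_def)
  \<comment> \<open>Fatou's lemma transfers the bound for finite blocks to the remainder of the series.\<close>
  have D_bound: "(\<integral>\<^sup>+x. ennreal (\<bar>D m x\<bar> ^ 3) \<partial>M) \<le> ennreal (3 * sqrt (B m) * B m + R m)" for m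
  proof -
    let ?u = "\<lambda>n x. \<Sum>k<n. Z (k + m) x"
    have indep': "indep_vars (\<lambda>_. borel) (\<lambda>k. Z (k + m)) UNIV"
      by (rule indep_vars_reindex[of "\<lambda>_. borel"]) (auto intro: indep_vars_subset[OF indep])
    have "(\<integral>\<^sup>+x. ennreal (\<bar>D m x\<bar> ^ 3) \<partial>M) = (\<integral>\<^sup>+x. liminf (\<lambda>n. ennreal (\<bar>?u n x\<bar> ^ 3)) \<partial>M)"
    proof (rule nn_integral_cong_AE)
      show "AE x in M. ennreal (\<bar>D m x\<bar> ^ 3) = liminf (\<lambda>n. ennreal (\<bar>?u n x\<bar> ^ 3))"
        using sums
      proof eventually_elim
        case (elim x)
        have "(\<lambda>k. Z (k + m) x) sums D m x"
          using sums_split_initial_segment[OF elim, of m] by (simp add: D_def T_def)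
        then have "(\<lambda>n. ennreal (\<bar>?u n x\<bar> ^ 3)) \<longlonglongrightarrow> ennreal (\<bar>D m x\<bar> ^ 3)"
          unfolding sums_def by (intro tendsto_ennrealI tendsto_power tendsto_rabs)
        then show ?case by (intro lim_imp_Liminf[symmetric] sequentially_bot)
      qed
    qed
    also have "\<dots> \<le> liminf (\<lambda>n. \<integral>\<^sup>+x. ennreal (\<bar>?u n x\<bar> ^ 3) \<partial>M)"
      by (rule nn_integral_liminf) measurable
    also have "\<dots> \<le> ennreal (3 * sqrt (B m) * B m + R m)"
    proof (rule Liminf_le, simp, intro always_eventually allI)
      fix n
      note u = indep_centred_sum_moments[OF indep' Z3 EZ, of n]
      have "(\<Sum>k<n. expectation (\<lambda>x. (Z (k + m) x)\<^sup>2)) \<le> B m"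
        unfolding B_def using s2
        by (intro sum_le_suminf) (auto simp: summable_iff_shift[of "\<lambda>k. expectation (\<lambda>x. (Z k x)\<^sup>2)"])
      moreover have "0 \<le> (\<Sum>k<n. expectation (\<lambda>x. (Z (k + m) x)\<^sup>2))"
        by (intro sum_nonneg) auto
      ultimately have "3 * sqrt (\<Sum>k<n. expectation (\<lambda>x. (Z (k + m) x)\<^sup>2)) * (\<Sum>k<n. expectation (\<lambda>x. (Z (k + m) x)\<^sup>2))
          \<le> 3 * sqrt (B m) * B m"
        using B0[of m] by (intro mult_mono) auto
      moreover have "(\<Sum>k<n. expectation (\<lambda>x. \<bar>Z (k + m) x\<bar> ^ 3)) \<le> R m"
        unfolding R_def using s3
        by (intro sum_le_suminf) (auto simp: summable_iff_shift[of "\<lambda>k. expectation (\<lambda>x. \<bar>Z k x\<bar> ^ 3)"])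
      ultimately have "expectation (\<lambda>x. \<bar>?u n x\<bar> ^ 3) \<le> 3 * sqrt (B m) * B m + R m"
        using u by linarith
      moreover have "(\<integral>\<^sup>+x. ennreal (\<bar>?u n x\<bar> ^ 3) \<partial>M) = ennreal (expectation (\<lambda>x. \<bar>?u n x\<bar> ^ 3))"
        using u by (intro nn_integral_eq_integral) auto
      ultimately show "(\<integral>\<^sup>+x. ennreal (\<bar>?u n x\<bar> ^ 3) \<partial>M) \<le> ennreal (3 * sqrt (B m) * B m + R m)"
        by (simp add: ennreal_leI)
    qed
    finally show ?thesis .
  qed
  have D3: "integrable M (\<lambda>x. \<bar>D m x\<bar> ^ 3)" for m
  proof (rule integrableI_bounded)
    show "(\<integral>\<^sup>+x. ennreal (norm (\<bar>D m x\<bar> ^ 3)) \<partial>M) < \<infinity>"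
      using D_bound[of m] by (simp add: order_le_less_trans)
  qed measurable
  have ED_le: "expectation (\<lambda>x. \<bar>D m x\<bar> ^ 3) \<le> 3 * sqrt (B m) * B m + R m" for m
  proof -
    have "R m \<ge> 0"
      unfolding R_def using s3
      by (intro suminf_nonneg) (auto simp: summable_iff_shift[of "\<lambda>k. expectation (\<lambda>x. \<bar>Z k x\<bar> ^ 3)"])
    moreover have "ennreal (expectation (\<lambda>x. \<bar>D m x\<bar> ^ 3)) \<le> ennreal (3 * sqrt (B m) * B m + R m)"
      using D_bound[of m] nn_integral_eq_integral[OF D3[of m]] by simp
    ultimately show ?thesis using B0[of m] by (subst (asm) ennreal_le_iff) auto
  qed
  have ED_lim: "(\<lambda>m. 4 * expectation (\<lambda>x. \<bar>D m x\<bar> ^ 3)) \<longlonglongrightarrow> 0"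
    by (rule tendsto_mult_right_zero, rule tendsto_sandwich[OF _ _ tendsto_const e_lim])
       (use ED_le in auto)
  \<comment> \<open>\<open>D 0\<close> is the whole sum \<open>S\<close>, so the remainder bound
    also gives integrability of its cube.\<close>
  have S3: "integrable M (\<lambda>x. \<bar>S x\<bar> ^ 3)"
    using D3[of 0] by (simp add: D_def T_def)
  have cube_le: "\<bar>T n x\<bar> ^ 3 \<le> 4 * \<bar>S x\<bar> ^ 3 + 4 * \<bar>D n x\<bar> ^ 3" for n x
  proof -
    have "\<bar>T n x\<bar> ^ 3 \<le> (\<bar>S x\<bar> + \<bar>D n x\<bar>) ^ 3"
      by (intro power_mono) (auto simp: D_def)
    also have "\<dots> \<le> 4 * \<bar>S x\<bar> ^ 3 + 4 * \<bar>D n x\<bar> ^ 3"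
      by (rule add_cubed_le) auto
    finally show ?thesis .
  qed
  \<comment> \<open>The majorant splits into the fixed part \<open>1 + 4 * \<bar>S\<bar> ^ 3\<close>
    and the part \<open>4 * \<bar>D n\<bar> ^ 3\<close>, which vanishes in mean.\<close>
  have conv: "(\<lambda>n. expectation (\<lambda>x. T n x ^ p)) \<longlonglongrightarrow> expectation (\<lambda>x. S x ^ p)" if p: "p \<le> 3" for p
  proof (rule integral_tendsto_dominated_up_to_L1)
    show "AE x in M. (\<lambda>n. T n x ^ p) \<longlonglongrightarrow> S x ^ p"
      using T_lim by eventually_elim (intro tendsto_power)
    show "\<bar>T n x ^ p\<bar> \<le> (1 + 4 * \<bar>S x\<bar> ^ 3) + 4 * \<bar>D n x\<bar> ^ 3" for n x
      using abs_power_le_one_plus_cube[OF p, of "T n x"] cube_le[of n x] by (simp add: power_abs)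
    show "\<bar>S x ^ p\<bar> \<le> 1 + 4 * \<bar>S x\<bar> ^ 3" for x
      using abs_power_le_one_plus_cube[OF p, of "S x"] zero_le_power[of "\<bar>S x\<bar>" 3]
      by (simp only: power_abs) linarith
    show "(\<lambda>n. expectation (\<lambda>x. 4 * \<bar>D n x\<bar> ^ 3)) \<longlonglongrightarrow> 0"
      using ED_lim by simp
  qed (use S3 D3 in auto)
  show "expectation S = 0"
    using conv[of 1] moments(2) by (simp add: LIMSEQ_const_iff)
  have "(\<lambda>k. expectation (\<lambda>x. (Z k x)\<^sup>2)) sums expectation (\<lambda>x. (S x)\<^sup>2)"
    using conv[of 2] unfolding sums_def moments(3) by simp
  then show "expectation (\<lambda>x. (S x)\<^sup>2) = (\<Sum>k. expectation (\<lambda>x. (Z k x)\<^sup>2))"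
    by (simp add: sums_iff)
  have "(\<lambda>k. expectation (\<lambda>x. Z k x ^ 3)) sums expectation (\<lambda>x. S x ^ 3)"
    using conv[of 3] unfolding sums_def moments(4) by simp
  then show "expectation (\<lambda>x. S x ^ 3) = (\<Sum>k. expectation (\<lambda>x. Z k x ^ 3))"
    by (simp add: sums_iff)
qed

section \<open>Skewness of the partial sums\<close>

lemma (in prob_space) iid_integral_eq:
  fixes \<epsilon> :: "int \<Rightarrow> 'a \<Rightarrow> real" and f :: "real \<Rightarrow> real"
  assumes iid: "iid M \<epsilon>" and [measurable]: "f \<in> borel_measurable borel"
  shows "expectation (\<lambda>x. f (\<epsilon> i x)) = expectation (\<lambda>x. f (\<epsilon> j x))"
    and "integrable M (\<lambda>x. f (\<epsilon> i x)) \<longleftrightarrow> integrable M (\<lambda>x. f (\<epsilon> j x))"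
proof -
  have [measurable]: "\<epsilon> k \<in> borel_measurable M" for k
    using iid unfolding iid_def indep_vars_def by auto
  have distr: "distr M borel (\<epsilon> i) = distr M borel (\<epsilon> j)"
    using iid unfolding iid_def by auto
  have E: "expectation (\<lambda>x. f (\<epsilon> k x)) = (\<integral>y. f y \<partial>distr M borel (\<epsilon> k))" for k
    by (simp add: integral_distr)
  show "expectation (\<lambda>x. f (\<epsilon> i x)) = expectation (\<lambda>x. f (\<epsilon> j x))"
    unfolding E distr ..
  have I: "integrable M (\<lambda>x. f (\<epsilon> k x)) \<longleftrightarrow> integrable (distr M borel (\<epsilon> k)) f" for k
    by (simp add: integrable_distr_eq)
  show "integrable M (\<lambda>x. f (\<epsilon> i x)) \<longleftrightarrow> integrable M (\<lambda>x. f (\<epsilon> j x))"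
    unfolding I distr ..
qed

text \<open>Padding the series of \<open>X (n - j)\<close> with \<open>j\<close> leading zeros
  expresses all summands through the same innovations \<open>\<epsilon> (n - k)\<close>; finitely
  many convergent series may then be added termwise.\<close>

lemma (in prob_space) partial_sum_sums:
  assumes lp: "linear_process M a \<epsilon> X"
  shows "AE x in M. (\<lambda>k. block_coeff a n k * \<epsilon> (int n - int k) x) sums partial_sum X n x"
proof -
  \<comment> \<open>One null set serves all times, since there are countably many.\<close>
  have "AE x in M. \<forall>t. (\<lambda>i. a i * \<epsilon> (t - int i) x) sums X t x"
    using lp unfolding linear_process_def AE_all_countable by blast
  then show ?thesis
  proof eventually_elim
    case (elim x)
    have shifted: "(\<lambda>k. (if j \<le> k then a (k - j) else 0) * \<epsilon> (int n - int k) x) sums X (int n - int j) x" for j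
    proof -
      let ?f = "\<lambda>k. (if j \<le> k then a (k - j) else 0) * \<epsilon> (int n - int k) x"
      have "(\<lambda>i. ?f (i + j)) = (\<lambda>i. a i * \<epsilon> (int n - int j - int i) x)"
        by (intro ext) (simp add: algebra_simps)
      then have "(\<lambda>i. ?f (i + j)) sums X (int n - int j) x"
        using elim by simp
      then have "?f sums (X (int n - int j) x + (\<Sum>k<j. ?f k))"
        by (rule sums_iff_shift[of ?f j, THEN iffD1])
      then show ?thesis by simp
    qed
    have "(\<lambda>k. \<Sum>j<n. (if j \<le> k then a (k - j) else 0) * \<epsilon> (int n - int k) x)
        sums (\<Sum>j<n. X (int n - int j) x)"
      by (intro sums_sum shifted)
    moreover have "(\<Sum>j<n. X (int n - int j) x) = partial_sum X n x"
      unfolding partial_sum_def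
      by (rule sum.reindex_bij_witness[of _ "\<lambda>t. nat (int n - t)" "\<lambda>j. int n - int j"]) auto
    ultimately show ?case
      by (simp add: block_coeff_def sum_distrib_right)
  qed
qed

text \<open>The series theorem is applied to \<open>block_coeff a n k * \<epsilon> (n - k)\<close>.
  Square summability of the coefficients controls the second moments and thereby also the third
  absolute ones.\<close>

lemma (in prob_space) partial_sum_moments:
  fixes \<epsilon> X :: "int \<Rightarrow> 'a \<Rightarrow> real"
  assumes iid: "iid M \<epsilon>" and i3: "integrable M (\<lambda>x. \<bar>\<epsilon> 1 x\<bar> ^ 3)"
    and E0: "expectation (\<epsilon> 1) = 0"
    and sq: "summable (\<lambda>i. (a i)\<^sup>2)" and lp: "linear_process M a \<epsilon> X"
  shows "variance (partial_sum X n) = variance (\<epsilon> 1) * (\<Sum>k. block_coeff a n k ^ 2)"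
    and "expectation (\<lambda>x. partial_sum X n x ^ 3) = expectation (\<lambda>x. \<epsilon> 1 x ^ 3) * (\<Sum>k. block_coeff a n k ^ 3)"
proof -
  define Z where "Z k x = block_coeff a n k * \<epsilon> (int n - int k) x" for k x
  have indep: "indep_vars (\<lambda>_. borel) Z UNIV"
  proof -
    have "inj (\<lambda>k. int n - int k)" by (auto intro: injI)
    moreover have "indep_vars (\<lambda>_. borel) \<epsilon> (range (\<lambda>k. int n - int k))"
      using iid unfolding iid_def by (auto intro: indep_vars_subset)
    ultimately have "indep_vars (\<lambda>_. borel) (\<lambda>k. \<epsilon> (int n - int k)) UNIV"
      by (rule indep_vars_reindex[of "\<lambda>_. borel" \<epsilon> "\<lambda>k. int n - int k" UNIV, rotated])
    then show ?thesis
      unfolding Z_def by (rule indep_vars_compose2) measurable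
  qed
  have [measurable]: "X t \<in> borel_measurable M" for t
    using lp unfolding linear_process_def by blast
  have S: "partial_sum X n \<in> borel_measurable M"
    unfolding partial_sum_def[abs_def] by measurable
  note same = iid_integral_eq[OF iid, of _ _ 1]
  have "integrable M (\<lambda>x. \<bar>\<epsilon> j x\<bar> ^ 3)" for j
    using same(2)[of "\<lambda>y. \<bar>y\<bar> ^ 3" j] i3 by simp
  then have Z3: "integrable M (\<lambda>x. \<bar>Z k x\<bar> ^ 3)" for k
    unfolding Z_def abs_mult power_mult_distrib by (intro integrable_mult_right) auto
  have EZ: "expectation (Z k) = 0" for k
    using same(1)[of "\<lambda>y. y" "int n - int k"] E0 unfolding Z_def by simp
  have Z2: "expectation (\<lambda>x. (Z k x)\<^sup>2) = variance (\<epsilon> 1) * (block_coeff a n k)\<^sup>2" for k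
    using same(1)[of "\<lambda>y. y\<^sup>2" "int n - int k"] E0 unfolding Z_def by (simp add: power_mult_distrib)
  have Zc: "expectation (\<lambda>x. Z k x ^ 3) = expectation (\<lambda>x. \<epsilon> 1 x ^ 3) * block_coeff a n k ^ 3" for k
    using same(1)[of "\<lambda>y. y ^ 3" "int n - int k"] unfolding Z_def by (simp add: power_mult_distrib)
  have Za: "expectation (\<lambda>x. \<bar>Z k x\<bar> ^ 3) = expectation (\<lambda>x. \<bar>\<epsilon> 1 x\<bar> ^ 3) * \<bar>block_coeff a n k\<bar> ^ 3" for k
    using same(1)[of "\<lambda>y. \<bar>y\<bar> ^ 3" "int n - int k"] unfolding Z_def by (simp add: power_mult_distrib abs_mult)
  note b2 = summable_block_coeff_square[OF sq, of n]
  note b3 = summable_abs_power_of_square[OF b2, of 3]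
  have s2: "summable (\<lambda>k. expectation (\<lambda>x. (Z k x)\<^sup>2))"
    unfolding Z2 by (intro summable_mult b2)
  have s3: "summable (\<lambda>k. expectation (\<lambda>x. \<bar>Z k x\<bar> ^ 3))"
    unfolding Za by (intro summable_mult b3) simp
  have sums: "AE x in M. (\<lambda>k. Z k x) sums partial_sum X n x"
    unfolding Z_def by (rule partial_sum_sums[OF lp])
  note m = indep_centred_series_moments[OF indep Z3 EZ s2 s3 S sums]
  show "variance (partial_sum X n) = variance (\<epsilon> 1) * (\<Sum>k. block_coeff a n k ^ 2)"
    unfolding m(1) using m(2) suminf_mult[OF b2, of "variance (\<epsilon> 1)"] by (simp add: Z2)
  have "summable (\<lambda>k. block_coeff a n k ^ 3)"
    using b3 by (intro summable_rabs_cancel[of "\<lambda>k. block_coeff a n k ^ 3"]) (simp add: power_abs)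
  from suminf_mult[OF this]
  show "expectation (\<lambda>x. partial_sum X n x ^ 3) = expectation (\<lambda>x. \<epsilon> 1 x ^ 3) * (\<Sum>k. block_coeff a n k ^ 3)"
    using m(3) by (simp add: Zc)
qed

theorem corollary1:
  fixes M :: "'w measure"
    and \<epsilon> X :: "int \<Rightarrow> 'w \<Rightarrow> real"
    and a :: "nat \<Rightarrow> real"
    and d \<sigma> \<eta> v :: real
  assumes "prob_space M"
    and "iid M \<epsilon>"
    and "integrable M (\<lambda>\<omega>. \<bar>\<epsilon> 1 \<omega>\<bar> ^ 3)"
    and "prob_space.expectation M (\<epsilon> 1) = 0"
    and "\<sigma> > 0" and "prob_space.variance M (\<epsilon> 1) = \<sigma>\<^sup>2"
    and "\<eta> = prob_space.expectation M (\<lambda>\<omega>. \<epsilon> 1 \<omega> ^ 3)"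
    and "summable (\<lambda>i. (a i)\<^sup>2)"
    and "linear_process M a \<epsilon> X"
    and "0 \<le> d" and "d < 1/2"
    and "has_memory d a"
    and "(\<lambda>n. real n powr (- 1 - 2 * d) * prob_space.variance M (partial_sum X n)) \<longlonglongrightarrow> v"
    and "v > 0"
    and "d = 0 \<Longrightarrow> (\<Sum>i. a i) > 0"
  shows "(\<lambda>n. sqrt (real n) * skewness_sum M X n) \<longlonglongrightarrow> skewness_limit \<eta> \<sigma> d"
proof -
  interpret prob_space M by fact
  define Q where "Q p n = (\<Sum>k. block_coeff a n k ^ p)" for p n
  define I where "I p = 1 / (1 + real p * d) + (LBINT x:{0..}. ((1 + x) powr d - x powr d) ^ p)" for p
  obtain C where C: "C > 0"
    and lim: "\<And>p. p \<ge> 2 \<Longrightarrow> (\<lambda>n. Q p n / real n powr (1 + real p * d)) \<longlonglongrightarrow> C ^ p * I p"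
    using block_coeff_power_sum_asymp[OF assms(10,11,12,8,15)] unfolding Q_def I_def by blast
  have var: "variance (partial_sum X n) = \<sigma>\<^sup>2 * Q 2 n"
    and cube: "expectation (\<lambda>x. partial_sum X n x ^ 3) = \<eta> * Q 3 n" for n
    using partial_sum_moments[OF assms(2,3,4,8,9), of n] assms(6,7) by (simp_all add: Q_def)
  have Q2: "Q 2 n \<ge> 0" for n
    unfolding Q_def by (intro suminf_nonneg summable_block_coeff_square assms) auto
  have "0 \<le> (LBINT x:{0..}. ((1 + x) powr d - x powr d) ^ 2)"
    unfolding set_lebesgue_integral_def by (intro integral_nonneg_AE) auto
  then have I2: "I 2 > 0" using \<open>0 \<le> d\<close> by (simp add: I_def add_pos_nonneg)
  \<comment> \<open>Used twice: to extract \<open>\<sigma> ^ 3\<close> from the variance of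
    \<open>S_n\<close>, and to extract \<open>C ^ 3\<close> from the limit so that it
    cancels.\<close>
  have scale: "(x ^ 2 * y) powr (3/2) = x ^ 3 * y powr (3/2)" if "x > 0" "y \<ge> 0" for x y :: real
  proof -
    have "x ^ 2 = x powr 2" using that by simp
    then have "(x ^ 2) powr (3/2) = x powr (2 * (3/2))" by (simp only: powr_powr)
    then have "(x ^ 2) powr (3/2) = x ^ 3" using that by simp
    then show ?thesis using that by (simp add: powr_mult)
  qed
  have "(\<lambda>n. \<eta> / \<sigma> ^ 3 * ((Q 3 n / real n powr (1 + real 3 * d))
        / (Q 2 n / real n powr (1 + real 2 * d)) powr (3/2)))
      \<longlonglongrightarrow> \<eta> / \<sigma> ^ 3 * ((C ^ 3 * I 3) / (C ^ 2 * I 2) powr (3/2))"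
    using C I2 by (intro tendsto_mult tendsto_divide tendsto_powr tendsto_const lim) auto
  moreover have "\<eta> / \<sigma> ^ 3 * ((C ^ 3 * I 3) / (C ^ 2 * I 2) powr (3/2)) = skewness_limit \<eta> \<sigma> d"
    using C I2 by (simp add: scale skewness_limit_def I_def mult.commute)
  moreover have "\<forall>\<^sub>F n in sequentially.
      \<eta> / \<sigma> ^ 3 * ((Q 3 n / real n powr (1 + real 3 * d)) / (Q 2 n / real n powr (1 + real 2 * d)) powr (3/2))
      = sqrt (real n) * skewness_sum M X n"
    using eventually_gt_at_top[of 0]
  proof eventually_elim
    case (elim n)
    \<comment> \<open>The exponents satisfy \<open>(1 + 2 * d) * 3/2 = (1 + 3 * d) + 1/2\<close>;
      the surplus 1/2 is the factor \<open>sqrt n\<close> of the statement.\<close>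
    have "(real n powr (1 + real 2 * d)) powr (3/2) = real n powr (1 + real 3 * d) * real n powr (1/2)"
      unfolding powr_powr powr_add[symmetric] by (rule arg_cong) (simp add: field_simps)
    then have "(Q 2 n / real n powr (1 + real 2 * d)) powr (3/2)
        = Q 2 n powr (3/2) / (real n powr (1 + real 3 * d) * sqrt (real n))"
      using Q2[of n] by (simp add: powr_divide powr_half_sqrt)
    moreover have "skewness_sum M X n = (\<eta> * Q 3 n) / (\<sigma> ^ 3 * Q 2 n powr (3/2))"
      unfolding skewness_sum_def var cube using scale[OF \<open>\<sigma> > 0\<close> Q2[of n]] by simp
    ultimately show ?case using elim by simp
  qed
  ultimately show ?thesis by (simp add: Lim_transform_eventually)
qed

end
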